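(* Let $0\le\gamma\le1$ and let $\mathcal N_\gamma^{AD}$ be the qubit amplitude damping channel $\mathcal N_\gamma^{AD}(\rho)=E_0\rho E_0^\dagger+E_1\rho E_1^\dagger$ with $E_0=|0\rangle\langle0|+\sqrt{1-\gamma}\,|1\rangle\langle1|$ and $E_1=\sqrt\gamma\,|0\rangle\langle1|$. Then $$C_{\mathrm{NS}\cap\mathrm{PPT}}(\mathcal N_\gamma^{AD})\le C_\zeta(\mathcal N_\gamma^{AD})=C_\beta(\mathcal N_\gamma^{AD})=\log\big(1+\sqrt{1-\gamma}\big).$$ As a consequence, $C(\mathcal N_\gamma^{AD})\le\log(1+\sqrt{1-\gamma})$.
   Context: $\log$ is base 2. For a channel $\mathcal N$ from $\mathcal L(A')$ to $\mathcal L(B)$ (finite-dimensional, $A\cong A'$), $J_{\mathcal N}=\sum_{i,j}|i\rangle\langle j|_A\otimes\mathcal N(|i\rangle\langle j|_{A'})$ is its Choi matrix and $T_B$ the partial transpose on $B$. Define $$\beta(\mathcal N)=\min\{\operatorname{Tr}S_B:\ -R_{AB}\le J_{\mathcal N}^{T_B}\le R_{AB},\ -\mathbb 1_A\otimes S_B\le R_{AB}^{T_B}\le\mathbb 1_A\otimes S_B\},$$ $$\zeta(\mathcal N)=\min\{\operatorname{Tr}S_B:\ V_{AB}\ge J_{\mathcal N},\ -\mathbb 1_A\otimes S_B\le V_{AB}^{T_B}\le\mathbb 1_A\otimes S_B\}$$ (over Hermitian operators), $C_\beta=\log\beta$, $C_\zeta=\log\zeta$. $C(\mathcal N)=\sup_{n\ge1}\chi(\mathcal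 N^{\otimes n})/n$ is the classical capacity, where $\chi(\mathcal N)=\max_{\{(p_i,\rho_i)\}}H(\sum_ip_i\mathcal N(\rho_i))-\sum_ip_iH(\mathcal N(\rho_i))$ and $H$ is the von Neumann entropy. Codes. A code for $m$ messages over $\mathcal N$ is a bipartite map $\Pi$ from $\mathcal L(A_i\otimes B_i)$ to $\mathcal L(A_o\otimes B_o)$ with $A_i=B_o=\mathbb C^m$, $A_o$ the input and $B_i$ the output system of $\mathcal N$. With $Z=Z_{A_iB_iA_oB_o}$ its Choi matrix (fewer subscripts denote marginals), $\Pi$ is an NS$\cap$PPT (no-signalling and PPT-preserving) code if $Z\ge0$, $Z_{A_iB_i}=\mathbb 1_{A_iB_i}$, $Z^{T_{B_iB_o}}\ge0$, $Z_{A_iB_iB_o}=\frac{\mathbb 1_{A_i}}{d_{A_i}}\otimes Z_{B_iB_o}$, $Z_{A_iB_iA_o}=\frac{\mathbb 1_{B_i}}{d_{B_i}}\otimes Z_{A_iA_o}$. The resulting channel $\mathcal M=\Pi\circ\mathcal N$ has Choi matrix $J_{\mathcal M}=\operatorname{Tr}_{A_oB_i}[(J_{\mathcal N}^T\otimes\mathbb 1_{A_iB_o})Z]$. $f_{\mathrm{NS}\cap\mathrm{PPT}}(\mathcal N,m)$ is the supremum over such codes of $\frac1m\sum_{k=1}^m\operatorname{Tr}(\mathcal M(|k\rangle\langle k|)|k\rangle\langle k|)$, and $C_{\mathrm{NS}\cap\mathrm{PPT}}(\mathcal N)=\sup\{r:\lim_{n\to\infty}f_{\mathrm{NS}\cap\mathrm{PPT}}(\mathcal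 N^{\otimes n},2^{rn})=1\}$, with $2^{rn}$ read as $\lfloor2^{rn}\rfloor$ when not an integer. *)

theory Defs
  imports
    "HOL-Analysis.Analysis"
    "HOL-Library.Countable_Set"
    "Jordan_Normal_Form.Char_Poly"
begin

text \<open>
  A finite-dimensional system with a distinguished orthonormal basis is given by the finite set
  of its basis labels, and operators are complex matrices indexed by labels; only entries at labels
  of the system are meaningful. Tensor products of systems are Cartesian products of label sets,
  so the dimensions of \<open>\<N>\<^sup>\<otimes>\<^sup>n\<close> and of the message systems may vary inside a statement.
\<close>

type_synonym 'a lop = "'a \<Rightarrow> 'a \<Rightarrow> complex"

definition id_op :: "'a lop" where
  "id_op = (\<lambda>i j. if i = j then 1 else 0)"

definition ketbra :: "'a \<Rightarrow> 'a \<Rightarrow> 'a lop" where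
  "ketbra i j = (\<lambda>k l. if k = i \<and> l = j then 1 else 0)"

definition mult_op :: "'a set \<Rightarrow> 'a lop \<Rightarrow> 'a lop \<Rightarrow> 'a lop" where
  "mult_op I M N = (\<lambda>i k. \<Sum>j\<in>I. M i j * N j k)"

definition adj_op :: "'a lop \<Rightarrow> 'a lop" where
  "adj_op M = (\<lambda>i j. cnj (M j i))"

definition transpose_op :: "'a lop \<Rightarrow> 'a lop" where
  "transpose_op M = (\<lambda>i j. M j i)"

definition trace_op :: "'a set \<Rightarrow> 'a lop \<Rightarrow> complex" where
  "trace_op I M = (\<Sum>i\<in>I. M i i)"

definition tensor_op :: "'a lop \<Rightarrow> 'b lop \<Rightarrow> ('a \<times> 'b) lop" where
  "tensor_op M N = (\<lambda>(a, b) (a', b'). M a a' * N b b')"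

definition ptranspose :: "('a \<times> 'b) lop \<Rightarrow> ('a \<times> 'b) lop" where
  "ptranspose M = (\<lambda>(a, b) (a', b'). M (a, b') (a', b))"

definition eq_op :: "'a set \<Rightarrow> 'a lop \<Rightarrow> 'a lop \<Rightarrow> bool" where
  "eq_op I M N \<longleftrightarrow> (\<forall>i\<in>I. \<forall>j\<in>I. M i j = N i j)"

definition hermitian_op :: "'a set \<Rightarrow> 'a lop \<Rightarrow> bool" where
  "hermitian_op I M \<longleftrightarrow> eq_op I (adj_op M) M"

definition psd_op :: "'a set \<Rightarrow> 'a lop \<Rightarrow> bool" where
  "psd_op I M \<longleftrightarrow> hermitian_op I M \<and>
     (\<forall>v. 0 \<le> Re (\<Sum>i\<in>I. \<Sum>j\<in>I. cnj (v i) * M i j * v j))"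

text \<open>The Loewner order; subtraction and negation of operators are pointwise.\<close>

definition loewner_le :: "'a set \<Rightarrow> 'a lop \<Rightarrow> 'a lop \<Rightarrow> bool" where
  "loewner_le I M N \<longleftrightarrow> psd_op I (N - M)"

definition density_op :: "'a set \<Rightarrow> 'a lop \<Rightarrow> bool" where
  "density_op I \<rho> \<longleftrightarrow> psd_op I \<rho> \<and> trace_op I \<rho> = 1"

definition choi :: "'a set \<Rightarrow> ('a lop \<Rightarrow> 'b lop) \<Rightarrow> ('a \<times> 'b) lop" where
  "choi A N = (\<lambda>x y. \<Sum>i\<in>A. \<Sum>j\<in>A. tensor_op (ketbra i j) (N (ketbra i j)) x y)"

lemma choi_entry:
  assumes "finite A" "a \<in> A" "a' \<in> A"
  shows "choi A N (a, b) (a', b') = N (ketbra a a') b b'"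
proof -
  have "choi A N (a, b) (a', b') =
      (\<Sum>i\<in>A. \<Sum>j\<in>A. if j = a' then (if i = a then N (ketbra i a') b b' else 0) else 0)"
    unfolding choi_def tensor_op_def ketbra_def by (auto intro!: sum.cong)
  then show ?thesis
    using assms by simp
qed

text \<open>The linear map with Choi matrix \<open>J\<close>, i.e. \<open>\<rho> \<mapsto> Tr\<^sub>A (J (\<rho>\<^sup>T \<otimes> 1))\<close>.\<close>

definition of_choi :: "'a set \<Rightarrow> ('a \<times> 'b) lop \<Rightarrow> 'a lop \<Rightarrow> 'b lop" where
  "of_choi A J \<rho> = (\<lambda>b b'. \<Sum>a\<in>A. \<Sum>a'\<in>A. \<rho> a a' * J (a, b) (a', b'))"

text \<open>Labels of the \<open>n\<close>-fold tensor power are lists of length \<open>n\<close>.\<close>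

definition sys_power :: "'a set \<Rightarrow> nat \<Rightarrow> 'a list set" where
  "sys_power A n = {xs. set xs \<subseteq> A \<and> length xs = n}"

text \<open>
  The linear extension of \<open>|a\<^sub>1\<rangle>\<langle>a'\<^sub>1| \<otimes> \<dots> \<otimes> |a\<^sub>n\<rangle>\<langle>a'\<^sub>n| \<mapsto> N(|a\<^sub>1\<rangle>\<langle>a'\<^sub>1|) \<otimes> \<dots> \<otimes> N(|a\<^sub>n\<rangle>\<langle>a'\<^sub>n|)\<close>.
\<close>

definition chan_power :: "'a set \<Rightarrow> ('a lop \<Rightarrow> 'b lop) \<Rightarrow> nat \<Rightarrow> 'a list lop \<Rightarrow> 'b list lop" where
  "chan_power A N n X = (\<lambda>b b'. \<Sum>a\<in>sys_power A n. \<Sum>a'\<in>sys_power A n.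
     X a a' * (\<Prod>k<n. N (ketbra (a ! k) (a' ! k)) (b ! k) (b' ! k)))"

text \<open>
  The traces of Hermitian operators are real. \<open>LEAST\<close> on \<open>real\<close> is the minimum where it exists,
  and is unspecified otherwise.
\<close>

definition beta :: "'a set \<Rightarrow> 'b set \<Rightarrow> ('a lop \<Rightarrow> 'b lop) \<Rightarrow> real" where
  "beta A B N = (LEAST t. \<exists>R S.
     hermitian_op (A \<times> B) R \<and> hermitian_op B S \<and>
     loewner_le (A \<times> B) (- R) (ptranspose (choi A N)) \<and>
     loewner_le (A \<times> B) (ptranspose (choi A N)) R \<and>
     loewner_le (A \<times> B) (- tensor_op id_op S) (ptranspose R) \<and>
     loewner_le (A \<times> B) (ptranspose R) (tensor_op id_op S) \<and>
     t = Re (trace_op B S))"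

definition zeta :: "'a set \<Rightarrow> 'b set \<Rightarrow> ('a lop \<Rightarrow> 'b lop) \<Rightarrow> real" where
  "zeta A B N = (LEAST t. \<exists>V S.
     hermitian_op (A \<times> B) V \<and> hermitian_op B S \<and>
     loewner_le (A \<times> B) (choi A N) V \<and>
     loewner_le (A \<times> B) (- tensor_op id_op S) (ptranspose V) \<and>
     loewner_le (A \<times> B) (ptranspose V) (tensor_op id_op S) \<and>
     t = Re (trace_op B S))"

definition C_beta :: "'a set \<Rightarrow> 'b set \<Rightarrow> ('a lop \<Rightarrow> 'b lop) \<Rightarrow> real" where
  "C_beta A B N = log 2 (beta A B N)"

definition C_zeta :: "'a set \<Rightarrow> 'b set \<Rightarrow> ('a lop \<Rightarrow> 'b lop) \<Rightarrow> real" where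
  "C_zeta A B N = log 2 (zeta A B N)"

definition mat_of_op :: "'a set \<Rightarrow> 'a lop \<Rightarrow> complex mat" where
  "mat_of_op I M =
     mat (card I) (card I) (\<lambda>(i, j). M (from_nat_into I i) (from_nat_into I j))"

text \<open>
  \<open>- Tr (\<rho> log \<rho>)\<close>, evaluated on the eigenvalues of \<open>\<rho>\<close> counted with multiplicity;
  the spectrum does not depend on the enumeration of the labels.
\<close>

definition vn_entropy :: "'a set \<Rightarrow> 'a lop \<Rightarrow> real" where
  "vn_entropy I \<rho> =
     - (\<Sum>l\<in>#proots (char_poly (mat_of_op I \<rho>)). Re l * log 2 (Re l))"

definition ensemble :: "'a set \<Rightarrow> nat \<Rightarrow> (nat \<Rightarrow> real) \<Rightarrow> (nat \<Rightarrow> 'a lop) \<Rightarrow> bool" where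
  "ensemble A k p \<rho> \<longleftrightarrow>
     (\<forall>i<k. 0 \<le> p i \<and> density_op A (\<rho> i)) \<and> (\<Sum>i<k. p i) = 1"

definition holevo :: "'a set \<Rightarrow> 'b set \<Rightarrow> ('a lop \<Rightarrow> 'b lop) \<Rightarrow> real" where
  "holevo A B N = Sup {vn_entropy B (\<lambda>x y. \<Sum>i<k. complex_of_real (p i) * N (\<rho> i) x y)
                       - (\<Sum>i<k. p i * vn_entropy B (N (\<rho> i))) | k p \<rho>. ensemble A k p \<rho>}"

definition classical_capacity :: "'a set \<Rightarrow> 'b set \<Rightarrow> ('a lop \<Rightarrow> 'b lop) \<Rightarrow> real" where
  "classical_capacity A B N =
     (SUP n\<in>{1..}. holevo (sys_power A n) (sys_power B n) (chan_power A N n) / real n)"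

text \<open>
  A code for \<open>m\<close> messages over a map from \<open>A\<close> to \<open>B\<close> is given by its Choi matrix \<open>Z\<close>. Labels
  are ordered as \<open>(A\<^sub>i, B\<^sub>i, A\<^sub>o, B\<^sub>o)\<close>, with label sets \<open>{1..m}\<close>, \<open>B\<close>, \<open>A\<close> and \<open>{1..m}\<close>.
\<close>

definition nsppt_code ::
    "'a set \<Rightarrow> 'b set \<Rightarrow> nat \<Rightarrow> (nat \<times> 'b \<times> 'a \<times> nat) lop \<Rightarrow> bool" where
  "nsppt_code A B m Z \<longleftrightarrow>
     (let Z_AiBi = (\<lambda>(ai, bi) (ai', bi'). \<Sum>ao\<in>A. \<Sum>bo\<in>{1..m}.
                      Z (ai, bi, ao, bo) (ai', bi', ao, bo));
          Z_AiBiBo = (\<lambda>(ai, bi, bo) (ai', bi', bo'). \<Sum>ao\<in>A.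
                      Z (ai, bi, ao, bo) (ai', bi', ao, bo'));
          Z_BiBo = (\<lambda>(bi, bo) (bi', bo'). \<Sum>ai\<in>{1..m}. \<Sum>ao\<in>A.
                      Z (ai, bi, ao, bo) (ai, bi', ao, bo'));
          Z_AiBiAo = (\<lambda>(ai, bi, ao) (ai', bi', ao'). \<Sum>bo\<in>{1..m}.
                      Z (ai, bi, ao, bo) (ai', bi', ao', bo));
          Z_AiAo = (\<lambda>(ai, ao) (ai', ao'). \<Sum>bi\<in>B. \<Sum>bo\<in>{1..m}.
                      Z (ai, bi, ao, bo) (ai', bi, ao', bo))
      in psd_op ({1..m} \<times> B \<times> A \<times> {1..m}) Z \<and>
         eq_op ({1..m} \<times> B) Z_AiBi id_op \<and>
         psd_op ({1..m} \<times> B \<times> A \<times> {1..m})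
           (\<lambda>(ai, bi, ao, bo) (ai', bi', ao', bo'). Z (ai, bi', ao, bo') (ai', bi, ao', bo)) \<and>
         eq_op ({1..m} \<times> B \<times> {1..m}) Z_AiBiBo
           (\<lambda>(ai, bi, bo) (ai', bi', bo').
              id_op ai ai' / of_nat (card {1..m}) * Z_BiBo (bi, bo) (bi', bo')) \<and>
         eq_op ({1..m} \<times> B \<times> A) Z_AiBiAo
           (\<lambda>(ai, bi, ao) (ai', bi', ao').
              id_op bi bi' / of_nat (card B) * Z_AiAo (ai, ao) (ai', ao')))"

text \<open>
  \<open>Tr\<^bsub>A\<^sub>oB\<^sub>i\<^esub> [(J\<^sub>N\<^sup>T \<otimes> 1) Z]\<close> with \<open>J\<^sub>N\<close> acting on \<open>A\<^sub>oB\<^sub>i\<close> and the identity on \<open>A\<^sub>iB\<^sub>o\<close>.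
\<close>

definition coded_choi :: "'a set \<Rightarrow> 'b set \<Rightarrow> ('a lop \<Rightarrow> 'b lop) \<Rightarrow> nat
    \<Rightarrow> (nat \<times> 'b \<times> 'a \<times> nat) lop \<Rightarrow> (nat \<times> nat) lop" where
  "coded_choi A B N m Z =
     (let W = mult_op ({1..m} \<times> B \<times> A \<times> {1..m})
            (\<lambda>(ai, bi, ao, bo) (ai', bi', ao', bo').
               transpose_op (choi A N) (ao, bi) (ao', bi') * (id_op ai ai' * id_op bo bo')) Z
      in (\<lambda>(ai, bo) (ai', bo'). \<Sum>ao\<in>A. \<Sum>bi\<in>B. W (ai, bi, ao, bo) (ai', bi, ao, bo')))"

definition success_prob :: "'a set \<Rightarrow> 'b set \<Rightarrow> ('a lop \<Rightarrow> 'b lop) \<Rightarrow> nat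
    \<Rightarrow> (nat \<times> 'b \<times> 'a \<times> nat) lop \<Rightarrow> real" where
  "success_prob A B N m Z =
     (let M = of_choi {1..m} (coded_choi A B N m Z)
      in 1 / real m *
         (\<Sum>k\<in>{1..m}. Re (trace_op {1..m} (mult_op {1..m} (M (ketbra k k)) (ketbra k k)))))"

definition f_nsppt :: "'a set \<Rightarrow> 'b set \<Rightarrow> ('a lop \<Rightarrow> 'b lop) \<Rightarrow> nat \<Rightarrow> real" where
  "f_nsppt A B N m = (SUP Z\<in>{Z. nsppt_code A B m Z}. success_prob A B N m Z)"

text \<open>
  A rate \<open>r < 0\<close> would mean \<open>m = 0\<close> messages for \<open>n \<ge> 1\<close>; then \<open>f_nsppt\<close> is \<open>0\<close>, so that only
  rates \<open>r \<ge> 0\<close> occur.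
\<close>

definition C_nsppt :: "'a set \<Rightarrow> 'b set \<Rightarrow> ('a lop \<Rightarrow> 'b lop) \<Rightarrow> real" where
  "C_nsppt A B N = Sup {r.
     (\<lambda>n. f_nsppt (sys_power A n) (sys_power B n) (chan_power A N n)
            (nat \<lfloor>2 powr (r * real n)\<rfloor>)) \<longlonglongrightarrow> 1}"

definition qubit :: "nat set" where
  "qubit = {0, 1}"

definition AD_E0 :: "real \<Rightarrow> nat lop" where
  "AD_E0 \<gamma> = (\<lambda>i j. ketbra 0 0 i j + complex_of_real (sqrt (1 - \<gamma>)) * ketbra 1 1 i j)"

definition AD_E1 :: "real \<Rightarrow> nat lop" where
  "AD_E1 \<gamma> = (\<lambda>i j. complex_of_real (sqrt \<gamma>) * ketbra 0 1 i j)"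

definition amp_damp :: "real \<Rightarrow> nat lop \<Rightarrow> nat lop" where
  "amp_damp \<gamma> \<rho> = (\<lambda>i j.
     mult_op qubit (mult_op qubit (AD_E0 \<gamma>) \<rho>) (adj_op (AD_E0 \<gamma>)) i j +
     mult_op qubit (mult_op qubit (AD_E1 \<gamma>) \<rho>) (adj_op (AD_E1 \<gamma>)) i j)"

end

theory Submission
  imports Defs "Jordan_Normal_Form.Schur_Decomposition"
begin

text \<open>
  Let \<open>(V, S)\<close> be feasible for \<open>\<zeta>(\<N>)\<close>. Its tensor powers are feasible for \<open>\<N>\<^sup>\<otimes>\<^sup>n\<close>, because positivity
  survives entrywise products. For a code of size \<open>m\<close> with \<open>F = \<Sum>\<^sub>k Z\<^sub>k\<^sub>k\<close> one has
  \<open>m\<cdot>success = Tr J F \<le> Tr V F = Tr V\<^sup>T F\<^sup>T \<le> Tr (1 \<otimes> S) F\<^sup>T = Tr S\<close> (partial transposes; \<open>F\<^sup>T \<ge> 0\<close> is the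
  PPT condition and \<open>Tr\<^sub>A F = 1\<close> is no-signalling), so the success probability decays exponentially
  at every rate above \<open>log Tr S\<close>.

  The bound on \<open>C\<close> does not pass through codes: \<open>\<N>(\<rho>) \<le> V(\<rho>) \<le> S\<^sup>T\<close> for every state \<open>\<rho>\<close>, since on the
  output the partial transpose is a transpose. Hence every output has relative entropy at most
  \<open>log Tr S\<close> to the single state \<open>S\<^sup>T / Tr S\<close>, which bounds \<open>\<chi>\<close>. As \<open>S\<close> is diagonal here, this only
  needs the spectral theorem and \<open>ln x \<le> x - 1\<close>. A perturbation \<open>S + \<epsilon>\<close> makes \<open>S\<close> invertible.

  For the amplitude damping channel all operators involved are X-shaped, and \<open>\<zeta>\<close> and \<open>\<beta>\<close> have
  explicit primal and dual optima with value \<open>1 + \<surd>(1 - \<gamma>)\<close>.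
\<close>

section \<open>Positive semidefinite operators\<close>

definition quad_form :: "'a set \<Rightarrow> 'a lop \<Rightarrow> ('a \<Rightarrow> complex) \<Rightarrow> complex" where
  "quad_form I M v = (\<Sum>i\<in>I. \<Sum>j\<in>I. cnj (v i) * M i j * v j)"

lemma psd_op_iff:
  "psd_op I M \<longleftrightarrow> (\<forall>i\<in>I. \<forall>j\<in>I. cnj (M j i) = M i j) \<and> (\<forall>v. 0 \<le> Re (quad_form I M v))"
  by (simp add: psd_op_def hermitian_op_def eq_op_def adj_op_def quad_form_def)

lemma quad_form_cong:
  assumes "\<And>i j. i \<in> I \<Longrightarrow> j \<in> I \<Longrightarrow> M i j = N i j"
  shows "quad_form I M v = quad_form I N v"
  unfolding quad_form_def using assms by (intro sum.cong) auto

lemma psd_op_cong: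
  assumes "psd_op I M" and "\<And>i j. i \<in> I \<Longrightarrow> j \<in> I \<Longrightarrow> M i j = N i j"
  shows "psd_op I N"
  using assms quad_form_cong[of I M N] by (simp add: psd_op_iff)

lemma psd_op_hermD: "psd_op I M \<Longrightarrow> i \<in> I \<Longrightarrow> j \<in> I \<Longrightarrow> cnj (M j i) = M i j"
  by (auto simp: psd_op_iff)

lemma psd_op_quadD: "psd_op I M \<Longrightarrow> 0 \<le> Re (quad_form I M v)"
  by (auto simp: psd_op_iff)

lemma psd_op_add:
  assumes "psd_op I M" "psd_op I N"
  shows "psd_op I (\<lambda>i j. M i j + N i j)"
proof -
  have "quad_form I (\<lambda>i j. M i j + N i j) v = quad_form I M v + quad_form I N v" for v
    by (simp add: quad_form_def algebra_simps sum.distrib)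
  then show ?thesis
    using assms by (simp add: psd_op_iff)
qed

lemma psd_op_scale:
  assumes "psd_op I M" "0 \<le> c"
  shows "psd_op I (\<lambda>i j. complex_of_real c * M i j)"
proof -
  have "quad_form I (\<lambda>i j. complex_of_real c * M i j) v = complex_of_real c * quad_form I M v" for v
    by (simp add: quad_form_def sum_distrib_left mult_ac)
  then show ?thesis
    using assms by (simp add: psd_op_iff)
qed

lemma psd_op_zero: "psd_op I (\<lambda>i j. 0)"
  by (simp add: psd_op_iff quad_form_def)

lemma psd_op_sum:
  assumes "\<And>k. k \<in> K \<Longrightarrow> psd_op I (M k)"
  shows "psd_op I (\<lambda>i j. \<Sum>k\<in>K. M k i j)"
  using assms by (induction K rule: infinite_finite_induct) (auto intro: psd_op_add psd_op_zero)

lemma quad_form_rank_one: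
  "quad_form I (\<lambda>i j. x i * cnj (x j)) v = (\<Sum>i\<in>I. cnj (v i) * x i) * cnj (\<Sum>i\<in>I. cnj (v i) * x i)"
  unfolding quad_form_def cnj_sum sum_product by (intro sum.cong) (auto simp: mult_ac)

lemma psd_op_rank_one: "psd_op I (\<lambda>i j. x i * cnj (x j))"
  by (simp add: psd_op_iff quad_form_rank_one complex_mult_cnj mult.commute del: cnj_sum)

lemma quad_form_fun_upd_insert:
  assumes "finite I" "a \<notin> I"
  shows "quad_form (insert a I) M (v(a := t)) =
    cnj t * M a a * t + cnj t * (\<Sum>j\<in>I. M a j * v j) + (\<Sum>i\<in>I. cnj (v i) * M i a) * t + quad_form I M v"
proof -
  let ?w = "v(a := t)"
  have "(\<Sum>j\<in>I. cnj (?w i) * M i j * ?w j) = cnj (?w i) * (\<Sum>j\<in>I. M i j * v j)" for i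
    unfolding sum_distrib_left using assms by (intro sum.cong) auto
  then have "quad_form (insert a I) M ?w =
     (\<Sum>i\<in>insert a I. cnj (?w i) * (M i a * t + (\<Sum>j\<in>I. M i j * v j)))"
    unfolding quad_form_def using assms by (simp add: algebra_simps)
  also have "\<dots> = cnj t * (M a a * t + (\<Sum>j\<in>I. M a j * v j)) +
     (\<Sum>i\<in>I. cnj (v i) * (M i a * t + (\<Sum>j\<in>I. M i j * v j)))"
  proof -
    have "(\<Sum>i\<in>I. cnj (?w i) * c i) = (\<Sum>i\<in>I. cnj (v i) * c i)" for c
      using assms by (intro sum.cong) auto
    then show ?thesis
      using assms by simp
  qed
  finally show ?thesis
    by (simp add: algebra_simps sum.distrib sum_distrib_left quad_form_def)
qed

lemma psd_op_mono:
  assumes "psd_op I M" "J \<subseteq> I" "finite I"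
  shows "psd_op J M"
proof -
  have "quad_form J M v = quad_form I M (\<lambda>i. if i \<in> J then v i else 0)" for v
    unfolding quad_form_def using assms(2,3)
    by (intro sum.mono_neutral_cong_left) (auto intro!: sum.mono_neutral_cong_left)
  then show ?thesis
    using assms by (simp add: psd_op_iff subset_iff)
qed

section \<open>Diagonal entries and Gram decompositions\<close>

lemma psd_op_diag_ge_0:
  assumes "psd_op I M" "i \<in> I" "finite I"
  shows "M i i = complex_of_real (Re (M i i))" and "0 \<le> Re (M i i)"
proof -
  show "M i i = complex_of_real (Re (M i i))"
    using psd_op_hermD[OF assms(1,2,2)] by (simp add: complex_eq_iff)
  have "0 \<le> Re (quad_form {i} M (\<lambda>_. 1))"
    using psd_op_quadD psd_op_mono[OF assms(1) _ assms(3), of "{i}"] assms(2) by blast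
  then show "0 \<le> Re (M i i)"
    by (simp add: quad_form_def)
qed

text \<open>A nonzero entry beside a zero on the diagonal would make the form negative somewhere on
  the span of the two labels.\<close>

lemma psd_op_zero_diag:
  assumes "psd_op I M" "i \<in> I" "j \<in> I" "finite I" and 0: "M i i = 0"
  shows "M i j = 0"
proof (rule ccontr)
  assume nz: "M i j \<noteq> 0"
  with 0 have "i \<noteq> j" by auto
  define c where "c = M i j"
  have ji: "M j i = cnj c"
    using psd_op_hermD[OF assms(1,3,2)] by (simp add: c_def)
  define d where "d = Re (M j j)"
  have psd: "psd_op {i, j} M"
    using psd_op_mono[OF assms(1) _ assms(4), of "{i,j}"] assms(2,3) by simp
  \<comment> \<open>The two cross terms together give -2 (d + 1) |c|^4 and the label
    \<open>j\<close> gives d |c|^4, so the total is negative for d \<ge> 0.\<close>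
  define v where "v = (\<lambda>k. if k = i then - complex_of_real (d + 1) * c else (cnj c * c))"
  have jj: "M j j = complex_of_real d"
    unfolding d_def using psd_op_diag_ge_0(1)[OF assms(1,3,4)] .
  have "0 \<le> Re (quad_form {i, j} M v)"
    by (rule psd_op_quadD[OF psd])
  also have "quad_form {i,j} M v = cnj (v i) * c * v j + cnj (v j) * cnj c * v i + cnj (v j) * complex_of_real d * v j"
    using \<open>i \<noteq> j\<close> 0 ji jj by (simp add: quad_form_def c_def[symmetric] algebra_simps)
  also have "\<dots> = complex_of_real ((d - 2 * (d + 1)) * (cmod c)^4)"
    using \<open>i \<noteq> j\<close> unfolding v_def
    by (simp add: complex_eq_iff cmod_power2 power4_eq_xxxx cmod_def algebra_simps power2_eq_square)
  finally have le: "0 \<le> (- d - 2) * (cmod c)^4" by simp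
  have "0 \<le> d"
    unfolding d_def by (rule psd_op_diag_ge_0(2)[OF assms(1,3,4)])
  moreover have "(cmod c)^4 > 0" using nz by (simp add: c_def)
  ultimately have "(- d - 2) * (cmod c)^4 < 0"
    by (intro mult_neg_pos) auto
  with le show False by simp
qed

text \<open>A Cholesky decomposition, found by splitting off one label at a time: the row and column
  of \<open>a\<close> extend to a rank-one operator, and the remainder is again positive on the
  other labels. It reduces closure properties of positive operators to rank-one operators.\<close>

lemma psd_op_gram:
  assumes "finite I" "psd_op I M"
  shows "\<exists>x :: 'a \<Rightarrow> 'a \<Rightarrow> complex. \<forall>i\<in>I. \<forall>j\<in>I. M i j = (\<Sum>k\<in>I. x k i * cnj (x k j))"
  using assms
proof (induction I arbitrary: M rule: finite_induct)
  case empty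
  then show ?case by simp
next
  case (insert a I)
  let ?I = "insert a I"
  define d where "d = Re (M a a)"
  have daa: "M a a = complex_of_real d"
    unfolding d_def using psd_op_diag_ge_0(1)[OF insert.prems, of a] insert.hyps by simp
  have d0: "0 \<le> d"
    unfolding d_def using psd_op_diag_ge_0(2)[OF insert.prems, of a] insert.hyps by simp
  have herm: "\<And>i j. i \<in> ?I \<Longrightarrow> j \<in> ?I \<Longrightarrow> cnj (M j i) = M i j"
    using psd_op_hermD[OF insert.prems] by blast
  \<comment> \<open>The column of \<open>a\<close> divided by the root of the pivot. For d = 0
    division by zero makes \<open>y\<close> vanish, in agreement with
    \<open>psd_op_zero_diag\<close>.\<close>
  define y where "y = (\<lambda>i. M i a / complex_of_real (sqrt d))"
  have y: "M i j = y i * cnj (y j)" if "i \<in> ?I" "j \<in> ?I" "i = a \<or> j = a" for i j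
  proof (cases "d = 0")
    case True
    then have "M a j = 0" "M a i = 0"
      using psd_op_zero_diag[OF insert.prems, of a] that insert.hyps daa by auto
    then have "M i j = 0" using herm[of i j] herm[of i a] that by auto
    then show ?thesis using True by (simp add: y_def)
  next
    case False
    then have sq: "complex_of_real (sqrt d) * complex_of_real (sqrt d) = complex_of_real d"
      using d0 by (metis of_real_mult real_sqrt_mult_self abs_of_nonneg)
    have "y i * cnj (y j) = M i a * M a j / complex_of_real d"
      using herm[of a j] that by (simp add: y_def sq)
    also have "\<dots> = M i j"
      using that False daa by auto
    finally show ?thesis by simp
  qed
  \<comment> \<open>The Schur complement of the label \<open>a\<close>: its form at \<open>v\<close> is that of \<open>M\<close> at the best extension of \<open>v\<close> to \<open>a\<close>.\<close>
  define N where "N = (\<lambda>i j. M i j - y i * cnj (y j))"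
  have "psd_op I N"
    unfolding psd_op_iff
  proof (intro conjI ballI allI)
    fix i j assume "i \<in> I" "j \<in> I"
    then show "cnj (N j i) = N i j" using herm by (simp add: N_def)
  next
    fix v
    define w where "w = (\<Sum>i\<in>I. cnj (v i) * y i)"
    have 1: "(\<Sum>i\<in>I. cnj (v i) * M i a) = w * cnj (y a)"
      unfolding w_def sum_distrib_right by (intro sum.cong) (auto simp: y)
    have 2: "(\<Sum>j\<in>I. M a j * v j) = y a * cnj w"
      unfolding w_def cnj_sum sum_distrib_left by (intro sum.cong) (auto simp: y)
    have Nq: "quad_form I N v = quad_form I M v - w * cnj w"
      unfolding w_def quad_form_rank_one[symmetric] by (simp add: N_def quad_form_def algebra_simps sum_subtractf)
    have "\<exists>t. Re (quad_form ?I M (v(a := t))) = Re (quad_form I N v)"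
    proof (cases "d = 0")
      case True
      then have "y a = 0" by (simp add: y_def)
      then have "y i = 0" for i by (simp add: y_def True)
      then have "w = 0" by (simp add: w_def)
      then show ?thesis
        unfolding quad_form_fun_upd_insert[OF insert.hyps] 1 2 Nq daa True by auto
    next
      case False
      then have ya: "y a \<noteq> 0" using daa d0 by (auto simp: y_def)
      \<comment> \<open>This value cancels the rank-one part of the form:
        \<open>w + cnj t * y a = 0\<close>.\<close>
      define t where "t = - cnj w / cnj (y a)"
      have "quad_form ?I M (v(a := t)) = quad_form I N v"
        unfolding quad_form_fun_upd_insert[OF insert.hyps] 1 2 Nq
        using y[of a a] ya by (simp add: t_def divide_simps)
      then show ?thesis by (intro exI[of _ t]) simp
    qed
    then show "0 \<le> Re (quad_form I N v)"
      using psd_op_quadD[OF insert.prems] by metis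
  qed
  from insert.IH[OF this] obtain x where x: "\<And>i j. i \<in> I \<Longrightarrow> j \<in> I \<Longrightarrow> N i j = (\<Sum>k\<in>I. x k i * cnj (x k j))"
    by blast
  define x' where "x' = (\<lambda>k i. if k = a then y i else if i = a then 0 else x k i)"
  have "M i j = (\<Sum>k\<in>?I. x' k i * cnj (x' k j))" if ij: "i \<in> ?I" "j \<in> ?I" for i j
  proof -
    have "(\<Sum>k\<in>?I. x' k i * cnj (x' k j)) = y i * cnj (y j) + (\<Sum>k\<in>I. x' k i * cnj (x' k j))"
      using insert.hyps by (simp add: x'_def)
    also have "(\<Sum>k\<in>I. x' k i * cnj (x' k j)) =
      (\<Sum>k\<in>I. (if i = a \<or> j = a then 0 else x k i * cnj (x k j)))"
      using insert.hyps by (intro sum.cong) (auto simp: x'_def)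
    finally show ?thesis
      using ij y[OF ij] x[of i j] by (cases "i = a \<or> j = a") (auto simp: N_def diff_eq_eq add.commute)
  qed
  then show ?case by blast
qed

section \<open>Entrywise products, reindexing and transposition\<close>

text \<open>Schur's product theorem: a Gram decomposition reduces \<open>M\<close> to rank one, and
  an entrywise product with a rank-one operator only rescales the test vector.\<close>

lemma psd_op_schur:
  assumes "finite I" "psd_op I M" "psd_op I N"
  shows "psd_op I (\<lambda>i j. M i j * N i j)"
proof -
  obtain x where x: "\<And>i j. i \<in> I \<Longrightarrow> j \<in> I \<Longrightarrow> M i j = (\<Sum>k\<in>I. x k i * cnj (x k j))"
    using psd_op_gram[OF assms(1,2)] by blast
  have "quad_form I (\<lambda>i j. (x k i * cnj (x k j)) * N i j) v = quad_form I N (\<lambda>i. cnj (x k i) * v i)" for k v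
    by (simp add: quad_form_def mult_ac)
  then have "psd_op I (\<lambda>i j. (x k i * cnj (x k j)) * N i j)" for k
    using assms(3) by (simp add: psd_op_iff)
  then have "psd_op I (\<lambda>i j. \<Sum>k\<in>I. (x k i * cnj (x k j)) * N i j)"
    by (intro psd_op_sum)
  then show ?thesis
    by (rule psd_op_cong) (simp add: x sum_distrib_right)
qed

text \<open>Gram vectors can be pulled back along \<open>f\<close>, also when \<open>f\<close>
  identifies labels. With \<open>f\<close> a projection this extends an operator on one factor to a
  product system, as a factor for entrywise products.\<close>

lemma psd_op_reindex:
  assumes "finite I" "finite J" "psd_op J M" "f ` I \<subseteq> J"
  shows "psd_op I (\<lambda>i j. M (f i) (f j))"
proof -
  obtain x where x: "\<And>i j. i \<in> J \<Longrightarrow> j \<in> J \<Longrightarrow> M i j = (\<Sum>k\<in>J. x k i * cnj (x k j))"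
    using psd_op_gram[OF assms(2,3)] by blast
  have "psd_op I (\<lambda>i j. \<Sum>k\<in>J. x k (f i) * cnj (x k (f j)))"
    by (intro psd_op_sum psd_op_rank_one)
  then show ?thesis
    by (rule psd_op_cong) (use assms(4) in \<open>simp add: x image_subset_iff\<close>)
qed

lemma psd_op_transpose:
  assumes "psd_op I M"
  shows "psd_op I (\<lambda>i j. M j i)"
proof -
  have "quad_form I (\<lambda>i j. M j i) v = quad_form I M (\<lambda>i. cnj (v i))" for v
    unfolding quad_form_def by (subst sum.swap) (simp add: mult_ac)
  then show ?thesis
    using assms by (simp add: psd_op_iff)
qed

text \<open>The form at the all-ones vector. Applied to an entrywise product of positive operators
  it plays the part of a trace inequality for their pairing.\<close>

lemma psd_op_sum_ge_0:
  assumes "psd_op I M"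
  shows "0 \<le> Re (\<Sum>i\<in>I. \<Sum>j\<in>I. M i j)"
  using psd_op_quadD[OF assms, of "\<lambda>_. 1"] by (simp add: quad_form_def)

lemma psd_op_id:
  assumes "finite I"
  shows "psd_op I id_op"
proof -
  have "quad_form I id_op v = (\<Sum>i\<in>I. cnj (v i) * v i)" for v
    unfolding quad_form_def id_op_def using assms
    by (intro sum.cong) (auto simp: if_distrib if_distribR cong: if_cong)
  then show ?thesis
    by (auto simp: psd_op_iff id_op_def Re_sum intro!: add_nonneg_nonneg sum_nonneg)
qed

lemma psd_op_all_ones: "psd_op I (\<lambda>i j. 1)"
  using psd_op_rank_one[of I "\<lambda>_. 1"] by simp

lemma psd_op_prod:
  assumes "finite I" "\<And>k. k \<in> K \<Longrightarrow> psd_op I (M k)"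
  shows "psd_op I (\<lambda>i j. \<Prod>k\<in>K. M k i j)"
  using assms(2)
proof (induction K rule: infinite_finite_induct)
  case (insert k K)
  then show ?case using psd_op_schur[OF assms(1), of "M k"] by simp
qed (auto intro: psd_op_all_ones)

text \<open>Telescoping: with \<open>n\<close> and \<open>m\<close> the products over the remaining
  indices, \<open>N k * n - M k * m = (N k - M k) * n + M k * (n - m)\<close>.\<close>

lemma psd_op_prod_mono:
  assumes "finite I" "\<And>k. k \<in> K \<Longrightarrow> psd_op I (M k)"
    "\<And>k. k \<in> K \<Longrightarrow> psd_op I (\<lambda>i j. N k i j - M k i j)"
  shows "psd_op I (\<lambda>i j. (\<Prod>k\<in>K. N k i j) - (\<Prod>k\<in>K. M k i j))"
  using assms(2,3)
proof (induction K rule: infinite_finite_induct)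
  case (insert k K)
  have N: "psd_op I (N l)" if "l \<in> insert k K" for l
    using psd_op_add[OF insert.prems(1)[OF that] insert.prems(2)[OF that]] by simp
  have "psd_op I (\<lambda>i j. (N k i j - M k i j) * (\<Prod>k\<in>K. N k i j)
      + M k i j * ((\<Prod>k\<in>K. N k i j) - (\<Prod>k\<in>K. M k i j)))"
    using insert N by (intro psd_op_add psd_op_schur psd_op_prod assms(1)) auto
  then show ?case using insert.hyps
    by (simp add: algebra_simps)
qed (auto intro: psd_op_zero)

text \<open>The relation -P \<le> X \<le> P passes to products although \<open>X\<close> may be
  indefinite, because 2 (P p - X x) = (P - X) (p + x) + (P + X) (p - x) and 2 (P p + X x) = (P - X)
  (p - x) + (P + X) (p + x).\<close>

lemma psd_op_prod_abs:
  assumes "finite I"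
    "\<And>k. k \<in> K \<Longrightarrow> psd_op I (\<lambda>i j. P k i j - X k i j)"
    "\<And>k. k \<in> K \<Longrightarrow> psd_op I (\<lambda>i j. P k i j + X k i j)"
  shows "psd_op I (\<lambda>i j. (\<Prod>k\<in>K. P k i j) - (\<Prod>k\<in>K. X k i j)) \<and>
    psd_op I (\<lambda>i j. (\<Prod>k\<in>K. P k i j) + (\<Prod>k\<in>K. X k i j))"
  using assms(2,3)
proof (induction K rule: infinite_finite_induct)
  case (insert k K)
  let ?p = "\<lambda>i j. \<Prod>k\<in>K. P k i j" and ?x = "\<lambda>i j. \<Prod>k\<in>K. X k i j"
  have IH: "psd_op I (\<lambda>i j. ?p i j - ?x i j)" "psd_op I (\<lambda>i j. ?p i j + ?x i j)"
    using insert by auto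
  have k: "psd_op I (\<lambda>i j. P k i j - X k i j)" "psd_op I (\<lambda>i j. P k i j + X k i j)"
    using insert.prems by auto
  have "psd_op I (\<lambda>i j. complex_of_real (1/2) * ((P k i j - X k i j) * (?p i j + ?x i j)
      + (P k i j + X k i j) * (?p i j - ?x i j)))"
    by (rule psd_op_scale[OF psd_op_add[OF psd_op_schur psd_op_schur]]) (use IH k assms(1) in auto)
  moreover have "psd_op I (\<lambda>i j. complex_of_real (1/2) * ((P k i j - X k i j) * (?p i j - ?x i j)
      + (P k i j + X k i j) * (?p i j + ?x i j)))"
    by (rule psd_op_scale[OF psd_op_add[OF psd_op_schur psd_op_schur]]) (use IH k assms(1) in auto)
  ultimately show ?case using insert.hyps
    by (simp add: algebra_simps)
next
  case empty
  show ?case using psd_op_add[OF psd_op_all_ones psd_op_all_ones] by (simp add: psd_op_zero)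
next
  case (infinite K)
  show ?case using infinite psd_op_add[OF psd_op_all_ones psd_op_all_ones] by (simp add: psd_op_zero)
qed

section \<open>Success probability of NS and PPT codes\<close>

lemma quad_form_diff:
  "quad_form I (\<lambda>i j. M i j - N i j) v = quad_form I M v - quad_form I N v"
  by (simp add: quad_form_def algebra_simps sum_subtractf)

definition tensor_id :: "'b lop \<Rightarrow> ('a \<times> 'b) lop" where
  "tensor_id S = (\<lambda>(a, b) (a', b'). if a = a' then S b b' else 0)"

lemma tensor_op_id: "tensor_op id_op S = tensor_id S"
  by (auto simp: tensor_op_def tensor_id_def id_op_def fun_eq_iff)

lemma loewner_le_iff: "loewner_le I M N \<longleftrightarrow> psd_op I (\<lambda>i j. N i j - M i j)"
  by (simp add: loewner_le_def fun_diff_def)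

lemma loewner_le_uminus_iff: "loewner_le I (- M) N \<longleftrightarrow> psd_op I (\<lambda>i j. N i j + M i j)"
  by (simp add: loewner_le_def fun_diff_def fun_Compl_def)

section \<open>The success probability as a pairing with the Choi matrix\<close>

text \<open>The identities on the message systems and the projections on message \<open>k\<close>
  fix all message labels to \<open>k\<close>. The transpose on the Choi matrix turns the trace into
  an entrywise pairing, the form that \<open>psd_op_schur\<close> can estimate.\<close>

lemma success_prob_eq:
  assumes "finite A" "finite B"
  shows "success_prob A B N m Z =
    1 / real m * Re (\<Sum>x\<in>A \<times> B. \<Sum>y\<in>A \<times> B. choi A N x y *
       (\<Sum>k\<in>{1..m}. Z (k, snd x, fst x, k) (k, snd y, fst y, k)))"
proof -
  let ?J = "choi A N"
  define M where "M = of_choi {1..m} (coded_choi A B N m Z)"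
  have W: "mult_op ({1..m} \<times> B \<times> A \<times> {1..m}) (\<lambda>(ai, bi, ao, bo) (ai', bi', ao', bo').
       transpose_op ?J (ao, bi) (ao', bi') * (id_op ai ai' * id_op bo bo')) Z (k, b, a, k) y
     = (\<Sum>x\<in>A \<times> B. ?J x (a, b) * Z (k, snd x, fst x, k) y)"
    if "k \<in> {1..m}" for k a b y
  proof -
    have "mult_op ({1..m} \<times> B \<times> A \<times> {1..m}) (\<lambda>(ai, bi, ao, bo) (ai', bi', ao', bo').
       transpose_op ?J (ao, bi) (ao', bi') * (id_op ai ai' * id_op bo bo')) Z (k, b, a, k) y
      = (\<Sum>(ai, b', a', bo)\<in>{1..m} \<times> B \<times> A \<times> {1..m}. if ai = k \<and> bo = k then ?J (a', b') (a, b) * Z (k, b', a', k) y else 0)"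
      unfolding mult_op_def by (intro sum.cong) (auto simp: id_op_def transpose_op_def)
    also have "\<dots> = (\<Sum>ai\<in>{1..m}. \<Sum>b'\<in>B. \<Sum>a'\<in>A. \<Sum>bo\<in>{1..m}. if ai = k \<and> bo = k then ?J (a', b') (a, b) * Z (k, b', a', k) y else 0)"
      by (simp add: sum.cartesian_product)
    also have "\<dots> = (\<Sum>ai\<in>{1..m}. if ai = k then \<Sum>b'\<in>B. \<Sum>a'\<in>A. ?J (a', b') (a, b) * Z (k, b', a', k) y else 0)"
      using that by (intro sum.cong) auto
    also have "\<dots> = (\<Sum>a'\<in>A. \<Sum>b'\<in>B. ?J (a', b') (a, b) * Z (k, b', a', k) y)"
      using that by (simp add: sum.swap[of _ A B])
    finally show ?thesis by (simp add: sum.cartesian_product split_def)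
  qed
  have C: "coded_choi A B N m Z (k, k) (k, k) =
     (\<Sum>x\<in>A \<times> B. \<Sum>y\<in>A \<times> B. ?J x y * Z (k, snd x, fst x, k) (k, snd y, fst y, k))"
    if "k \<in> {1..m}" for k
  proof -
    have "coded_choi A B N m Z (k, k) (k, k) = (\<Sum>a\<in>A. \<Sum>b\<in>B. \<Sum>x\<in>A \<times> B. ?J x (a, b) * Z (k, snd x, fst x, k) (k, b, a, k))"
      unfolding coded_choi_def Let_def by (simp add: W[OF that] del: One_nat_def)
    also have "\<dots> = (\<Sum>y\<in>A \<times> B. \<Sum>x\<in>A \<times> B. ?J x y * Z (k, snd x, fst x, k) (k, snd y, fst y, k))"
      by (simp add: sum.cartesian_product'[of _ A B])
    finally show ?thesis by (subst sum.swap)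
  qed
  have tr: "trace_op {1..m} (mult_op {1..m} (M (ketbra k k)) (ketbra k k)) = coded_choi A B N m Z (k, k) (k, k)"
    if k: "k \<in> {1..m}" for k
  proof -
    have "trace_op {1..m} (mult_op {1..m} (M (ketbra k k)) (ketbra k k)) =
      (\<Sum>i\<in>{1..m}. \<Sum>j\<in>{1..m}. if j = k then (if i = k then M (ketbra k k) k k else 0) else 0)"
      unfolding trace_op_def mult_op_def by (intro sum.cong) (auto simp: ketbra_def)
    also have "\<dots> = M (ketbra k k) k k"
      using k by simp
    also have "\<dots> = (\<Sum>a\<in>{1..m}. \<Sum>a'\<in>{1..m}. if a' = k then (if a = k then coded_choi A B N m Z (k, k) (k, k) else 0) else 0)"
      unfolding M_def of_choi_def by (intro sum.cong) (auto simp: ketbra_def)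
    also have "\<dots> = coded_choi A B N m Z (k, k) (k, k)"
      using k by simp
    finally show ?thesis .
  qed
  have "success_prob A B N m Z = 1 / real m * (\<Sum>k\<in>{1..m}. Re (trace_op {1..m} (mult_op {1..m} (M (ketbra k k)) (ketbra k k))))"
    by (simp add: success_prob_def Let_def M_def)
  also have "\<dots> = 1 / real m * Re (\<Sum>k\<in>{1..m}.
      (\<Sum>x\<in>A \<times> B. \<Sum>y\<in>A \<times> B. ?J x y * Z (k, snd x, fst x, k) (k, snd y, fst y, k)))"
    unfolding Re_sum by (intro arg_cong2[of _ _ _ _ "(*)"] sum.cong refl) (simp only: tr C Re_sum)
  also have "(\<Sum>k\<in>{1..m}. (\<Sum>x\<in>A \<times> B. \<Sum>y\<in>A \<times> B. ?J x y * Z (k, snd x, fst x, k) (k, snd y, fst y, k)))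
     = (\<Sum>x\<in>A \<times> B. \<Sum>y\<in>A \<times> B. \<Sum>k\<in>{1..m}. ?J x y * Z (k, snd x, fst x, k) (k, snd y, fst y, k))"
    by (subst sum.swap, intro sum.cong refl, subst sum.swap) simp
  finally show ?thesis
    by (simp add: sum_distrib_left)
qed

text \<open>Partial transposition permutes the pairs of labels in the same way for both factors, so
  the sum is only reordered.\<close>

lemma sum_ptranspose:
  fixes F G :: "('a \<times> 'b) lop"
  shows "(\<Sum>x\<in>A \<times> B. \<Sum>y\<in>A \<times> B. ptranspose F x y * ptranspose G x y) =
    (\<Sum>x\<in>A \<times> B. \<Sum>y\<in>A \<times> B. F x y * G x y)"
proof -
  have e: "(\<Sum>x\<in>A \<times> B. \<Sum>y\<in>A \<times> B. H x y) = (\<Sum>a\<in>A. \<Sum>a'\<in>A. \<Sum>b\<in>B. \<Sum>b'\<in>B. H (a, b) (a', b'))"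
    for H :: "('a \<times> 'b) lop"
    unfolding sum.cartesian_product' by (intro sum.cong refl) (rule sum.swap)
  show ?thesis
    unfolding e by (subst (3) sum.swap) (simp add: ptranspose_def)
qed

locale nsppt =
  fixes A :: "'a set" and B :: "'b set" and m :: nat and Z :: "(nat \<times> 'b \<times> 'a \<times> nat) lop"
  assumes fin: "finite A" "finite B" and code: "nsppt_code A B m Z"
begin

lemma psd: "psd_op ({1..m} \<times> B \<times> A \<times> {1..m}) Z"
  using code unfolding nsppt_code_def Let_def by (elim conjE)

lemma ppt: "psd_op ({1..m} \<times> B \<times> A \<times> {1..m})
    (\<lambda>(ai, bi, ao, bo) (ai', bi', ao', bo'). Z (ai, bi', ao, bo') (ai', bi, ao', bo))"
  using code unfolding nsppt_code_def Let_def by (elim conjE)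

lemma normalized:
  assumes "k \<in> {1..m}" "b \<in> B" "b' \<in> B"
  shows "(\<Sum>a\<in>A. \<Sum>j\<in>{1..m}. Z (k, b, a, j) (k, b', a, j)) = (if b = b' then 1 else 0)"
proof -
  from code have *: "\<forall>x\<in>{1..m} \<times> B. \<forall>y\<in>{1..m} \<times> B.
     (case x of (ai, bi) \<Rightarrow> \<lambda>(ai', bi'). \<Sum>ao\<in>A. \<Sum>bo\<in>{1..m}. Z (ai, bi, ao, bo) (ai', bi', ao, bo)) y = id_op x y"
    unfolding nsppt_code_def Let_def eq_op_def prod.case by (elim conjE)
  from bspec[OF bspec[OF *], of "(k, b)" "(k, b')"] assms show ?thesis
    by (simp add: id_op_def)
qed

text \<open>What the receiver sees under message \<open>k\<close> is the average over all messages.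
  Only blocks with equal message labels are recorded, as these are the ones that enter the success
  probability.\<close>

lemma no_signalling_A:
  assumes "k \<in> {1..m}" "b \<in> B" "b' \<in> B" "j \<in> {1..m}"
  shows "(\<Sum>a\<in>A. Z (k, b, a, j) (k, b', a, j)) =
     1 / of_nat m * (\<Sum>i\<in>{1..m}. \<Sum>a\<in>A. Z (i, b, a, j) (i, b', a, j))"
proof -
  from code have *: "\<forall>x\<in>{1..m} \<times> B \<times> {1..m}. \<forall>y\<in>{1..m} \<times> B \<times> {1..m}.
     (case x of (ai, bi, bo) \<Rightarrow> \<lambda>(ai', bi', bo'). \<Sum>ao\<in>A. Z (ai, bi, ao, bo) (ai', bi', ao, bo')) y =
     (case x of (ai, bi, bo) \<Rightarrow> \<lambda>(ai', bi', bo'). id_op ai ai' / of_nat (card {1..m}) *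
         (\<Sum>ai\<in>{1..m}. \<Sum>ao\<in>A. Z (ai, bi, ao, bo) (ai, bi', ao, bo'))) y"
    unfolding nsppt_code_def Let_def eq_op_def prod.case by (elim conjE)
  from bspec[OF bspec[OF *], of "(k, b, j)" "(k, b', j)"] assms show ?thesis
    by (simp add: id_op_def)
qed

lemma no_signalling_B:
  assumes "k \<in> {1..m}" "b \<in> B" "b' \<in> B" "a \<in> A" "a' \<in> A"
  shows "(\<Sum>j\<in>{1..m}. Z (k, b, a, j) (k, b', a', j)) =
     (if b = b' then 1 / of_nat (card B) * (\<Sum>b\<in>B. \<Sum>j\<in>{1..m}. Z (k, b, a, j) (k, b, a', j)) else 0)"
proof -
  from code have *: "\<forall>x\<in>{1..m} \<times> B \<times> A. \<forall>y\<in>{1..m} \<times> B \<times> A.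
     (case x of (ai, bi, ao) \<Rightarrow> \<lambda>(ai', bi', ao'). \<Sum>bo\<in>{1..m}. Z (ai, bi, ao, bo) (ai', bi', ao', bo)) y =
     (case x of (ai, bi, ao) \<Rightarrow> \<lambda>(ai', bi', ao'). id_op bi bi' / of_nat (card B) *
         (\<Sum>bi\<in>B. \<Sum>bo\<in>{1..m}. Z (ai, bi, ao, bo) (ai', bi, ao', bo))) y"
    unfolding nsppt_code_def Let_def eq_op_def prod.case by (elim conjE)
  from bspec[OF bspec[OF *], of "(k, b, a)" "(k, b', a')"] assms show ?thesis
    by (simp add: id_op_def)
qed

text \<open>Weak duality: the operator \<open>F\<close> built from the code is a feasible point of
  the dual program, so its value is bounded by that of the primal pair \<open>V\<close>,
  \<open>S\<close>.\<close>

lemma success_prob_le: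
  assumes VJ: "psd_op (A \<times> B) (\<lambda>x y. V x y - choi A N x y)"
    and SV: "psd_op (A \<times> B) (\<lambda>x y. tensor_id S x y - ptranspose V x y)"
  shows "success_prob A B N m Z \<le> Re (trace_op B S) / real m"
proof -
  define F where "F = (\<lambda>x y. \<Sum>k\<in>{1..m}. Z (k, snd x, fst x, k) (k, snd y, fst y, k))"
  have finm: "finite ({1..m} \<times> B \<times> A \<times> {1..m})" and finAB: "finite (A \<times> B)" using fin by auto
  have F: "psd_op (A \<times> B) F"
    unfolding F_def
  proof (rule psd_op_sum)
    fix k assume "k \<in> {1..m}"
    then show "psd_op (A \<times> B) (\<lambda>x y. Z (k, snd x, fst x, k) (k, snd y, fst y, k))"
      by (intro psd_op_reindex[OF finAB finm psd]) auto
  qed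
  have FT: "psd_op (A \<times> B) (ptranspose F)"
  proof -
    have "psd_op (A \<times> B) (\<lambda>x y. \<Sum>k\<in>{1..m}.
      (\<lambda>(ai, bi, ao, bo) (ai', bi', ao', bo'). Z (ai, bi', ao, bo') (ai', bi, ao', bo)) (k, snd x, fst x, k) (k, snd y, fst y, k))"
    proof (rule psd_op_sum)
      fix k assume "k \<in> {1..m}"
      then show "psd_op (A \<times> B) (\<lambda>x y. (\<lambda>(ai, bi, ao, bo) (ai', bi', ao', bo'). Z (ai, bi', ao, bo') (ai', bi, ao', bo)) (k, snd x, fst x, k) (k, snd y, fst y, k))"
        by (intro psd_op_reindex[OF finAB finm ppt]) auto
    qed
    then show ?thesis
      by (rule psd_op_cong) (auto simp: F_def ptranspose_def)
  qed
  \<comment> \<open>No signalling replaces the sender's message \<open>k\<close> by an average over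
    all messages; summing over the output label then brings in the normalization of
    \<open>Z\<close>. The factor 1 / m cancels against m equal terms, hence m > 0.\<close>
  have FB: "(\<Sum>a\<in>A. F (a, b) (a, b')) = (if b = b' then 1 else 0)" if b: "b \<in> B" "b' \<in> B" and "m > 0" for b b'
  proof -
    have "(\<Sum>a\<in>A. F (a, b) (a, b')) = (\<Sum>k\<in>{1..m}. \<Sum>a\<in>A. Z (k, b, a, k) (k, b', a, k))"
      unfolding F_def fst_conv snd_conv by (rule sum.swap)
    also have "\<dots> = (\<Sum>k\<in>{1..m}. 1 / of_nat m * (\<Sum>i\<in>{1..m}. \<Sum>a\<in>A. Z (i, b, a, k) (i, b', a, k)))"
      using b by (intro sum.cong refl no_signalling_A) auto
    also have "\<dots> = 1 / of_nat m * (\<Sum>k\<in>{1..m}. \<Sum>i\<in>{1..m}. \<Sum>a\<in>A. Z (i, b, a, k) (i, b', a, k))"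
      by (simp only: sum_distrib_left)
    also have "(\<Sum>k\<in>{1..m}. \<Sum>i\<in>{1..m}. \<Sum>a\<in>A. Z (i, b, a, k) (i, b', a, k)) =
      (\<Sum>i\<in>{1..m}. \<Sum>a\<in>A. \<Sum>k\<in>{1..m}. Z (i, b, a, k) (i, b', a, k))"
      by (subst sum.swap, intro sum.cong refl, subst sum.swap) simp
    also have "\<dots> = (\<Sum>i\<in>{1..m}. if b = b' then 1 else 0)"
      using b by (intro sum.cong refl normalized) auto
    finally show ?thesis using \<open>m > 0\<close> by simp
  qed
  have 1: "Re (\<Sum>x\<in>A \<times> B. \<Sum>y\<in>A \<times> B. choi A N x y * F x y) \<le> Re (\<Sum>x\<in>A \<times> B. \<Sum>y\<in>A \<times> B. V x y * F x y)"
    using psd_op_sum_ge_0[OF psd_op_schur[OF finAB VJ F]]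
    by (simp only: left_diff_distrib sum_subtractf minus_complex.simps diff_ge_0_iff_ge)
  have 2: "Re (\<Sum>x\<in>A \<times> B. \<Sum>y\<in>A \<times> B. ptranspose V x y * ptranspose F x y) \<le>
      Re (\<Sum>x\<in>A \<times> B. \<Sum>y\<in>A \<times> B. tensor_id S x y * ptranspose F x y)"
    using psd_op_sum_ge_0[OF psd_op_schur[OF finAB SV FT]]
    by (simp only: left_diff_distrib sum_subtractf minus_complex.simps diff_ge_0_iff_ge)
  have 3: "(\<Sum>x\<in>A \<times> B. \<Sum>y\<in>A \<times> B. tensor_id S x y * ptranspose F x y) = trace_op B S" if "m > 0"
  proof -
    have "(\<Sum>x\<in>A \<times> B. \<Sum>y\<in>A \<times> B. tensor_id S x y * ptranspose F x y) =
      (\<Sum>a\<in>A. \<Sum>b\<in>B. \<Sum>a'\<in>A. \<Sum>b'\<in>B. if a' = a then S b b' * F (a, b') (a, b) else 0)"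
      unfolding sum.cartesian_product' by (intro sum.cong refl) (simp add: tensor_id_def ptranspose_def)
    also have "\<dots> = (\<Sum>a\<in>A. \<Sum>b\<in>B. \<Sum>b'\<in>B. S b b' * F (a, b') (a, b))"
      using fin by (intro sum.cong refl) (subst sum.swap, simp)
    also have "\<dots> = (\<Sum>b\<in>B. \<Sum>b'\<in>B. S b b' * (\<Sum>a\<in>A. F (a, b') (a, b)))"
      by (subst sum.swap, intro sum.cong refl, subst sum.swap) (simp add: sum_distrib_left)
    also have "\<dots> = (\<Sum>b\<in>B. \<Sum>b'\<in>B. if b' = b then S b b' else 0)"
      using that by (intro sum.cong refl) (auto simp: FB)
    finally show ?thesis
      using fin by (simp add: trace_op_def)
  qed
  show ?thesis
  proof (cases "m > 0")
    case True
    have "Re (\<Sum>x\<in>A \<times> B. \<Sum>y\<in>A \<times> B. choi A N x y * F x y) \<le> Re (trace_op B S)"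
      using 1 2 unfolding 3[OF True] sum_ptranspose by linarith
    then show ?thesis
      unfolding success_prob_eq[OF fin] F_def by (simp add: divide_right_mono)
  next
    case False
    \<comment> \<open>For m = 0 both sides are 0, through division by zero.\<close>
    then show ?thesis unfolding success_prob_eq[OF fin] by simp
  qed
qed

end

section \<open>Codes for one message and existence of codes\<close>

text \<open>This makes rate 0 achievable. With a single message the output label is trivial, so no
  signalling from the receiver makes \<open>Z\<close> proportional to the identity on
  \<open>B\<close>. Trace preservation of the channel and normalization of the code then evaluate
  the pairing.\<close>

lemma success_prob_one_message:
  assumes "nsppt A B 1 Z" "B \<noteq> {}"
    and tp: "\<And>a a'. a \<in> A \<Longrightarrow> a' \<in> A \<Longrightarrow> (\<Sum>b\<in>B. choi A N (a, b) (a', b)) = (if a = a' then 1 else 0)"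
  shows "success_prob A B N 1 Z = 1"
proof -
  interpret nsppt A B 1 Z by fact
  have cB: "of_nat (card B) \<noteq> (0 :: complex)" using fin \<open>B \<noteq> {}\<close> by simp
  define R where "R = (\<lambda>a a'. \<Sum>b\<in>B. Z (1, b, a, 1) (1, b, a', 1))"
  have Z: "Z (1, b, a, 1) (1, b', a', 1) = (if b = b' then 1 / of_nat (card B) * R a a' else 0)"
    if "b \<in> B" "b' \<in> B" "a \<in> A" "a' \<in> A" for a a' b b'
    using no_signalling_B[of 1 b b' a a'] that by (simp add: R_def)
  have "(\<Sum>x\<in>A \<times> B. \<Sum>y\<in>A \<times> B. choi A N x y *
       (\<Sum>k\<in>{1..1::nat}. Z (k, snd x, fst x, k) (k, snd y, fst y, k))) =
     (\<Sum>a\<in>A. \<Sum>b\<in>B. \<Sum>a'\<in>A. \<Sum>b'\<in>B. choi A N (a, b) (a', b') * Z (1, b, a, 1) (1, b', a', 1))"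
    unfolding sum.cartesian_product' by simp
  also have "\<dots> = (\<Sum>a\<in>A. \<Sum>b\<in>B. \<Sum>a'\<in>A. \<Sum>b'\<in>B.
      if b' = b then choi A N (a, b) (a', b) * (1 / of_nat (card B) * R a a') else 0)"
    by (intro sum.cong refl) (auto simp: Z simp del: One_nat_def)
  also have "\<dots> = (\<Sum>a\<in>A. \<Sum>a'\<in>A. \<Sum>b\<in>B. choi A N (a, b) (a', b) * (1 / of_nat (card B) * R a a'))"
    using fin by (subst sum.swap[of _ A B]) simp
  also have "\<dots> = (\<Sum>a\<in>A. \<Sum>a'\<in>A. if a' = a then 1 / of_nat (card B) * R a a' else 0)"
    unfolding sum_distrib_right[symmetric] by (intro sum.cong refl) (simp add: tp)
  also have "\<dots> = 1 / of_nat (card B) * (\<Sum>a\<in>A. R a a)"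
    using fin by (simp add: sum_distrib_left)
  also have "(\<Sum>a\<in>A. R a a) = (\<Sum>b\<in>B. \<Sum>a\<in>A. Z (1, b, a, 1) (1, b, a, 1))"
    unfolding R_def by (rule sum.swap)
  also have "\<dots> = (\<Sum>b\<in>B. 1)"
    using normalized[of 1] by (intro sum.cong refl) auto
  finally show ?thesis
    unfolding success_prob_eq[OF fin] using cB by simp
qed

text \<open>The code that ignores its inputs and emits uniform noise. It ensures that the supremum
  in \<open>f_nsppt\<close> ranges over a nonempty set.\<close>

lemma nsppt_code_exists:
  fixes A :: "'a set" and B :: "'b set"
  assumes "finite A" "finite B" "A \<noteq> {}" "B \<noteq> {}" "m > 0"
  shows "\<exists>Z. nsppt_code A B m Z"
proof -
  define c where "c = 1 / (real m * real (card A))"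
  define Z :: "(nat \<times> 'b \<times> 'a \<times> nat) lop" where "Z = (\<lambda>x y. complex_of_real c * id_op x y)"
  have cA: "real (card A) > 0" "real (card B) > 0" using assms by (auto simp: card_gt_0_iff)
  have fin: "finite ({1..m} \<times> B \<times> A \<times> {1..m})" using assms by auto
  have psd: "psd_op ({1..m} \<times> B \<times> A \<times> {1..m}) Z"
    unfolding Z_def c_def using fin by (intro psd_op_scale psd_op_id) auto
  have Zeq: "Z (ai, bi, ao, bo) (ai', bi', ao', bo') =
    (if ai = ai' \<and> bi = bi' \<and> ao = ao' \<and> bo = bo' then complex_of_real c else 0)" for ai bi ao bo ai' bi' ao' bo'
    by (auto simp: Z_def id_op_def)
  have "nsppt_code A B m Z"
    unfolding nsppt_code_def Let_def
  proof (intro conjI psd)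
    show "psd_op ({1..m} \<times> B \<times> A \<times> {1..m})
           (\<lambda>(ai, bi, ao, bo) (ai', bi', ao', bo'). Z (ai, bi', ao, bo') (ai', bi, ao', bo))"
      by (rule psd_op_cong[OF psd]) (auto simp: Zeq)
  next
    show "eq_op ({1..m} \<times> B) (\<lambda>(ai, bi) (ai', bi'). \<Sum>ao\<in>A. \<Sum>bo\<in>{1..m}.
                      Z (ai, bi, ao, bo) (ai', bi', ao, bo)) id_op"
      unfolding eq_op_def using cA assms by (clarsimp simp: Zeq id_op_def c_def)
  next
    show "eq_op ({1..m} \<times> B \<times> {1..m}) (\<lambda>(ai, bi, bo) (ai', bi', bo'). \<Sum>ao\<in>A.
                      Z (ai, bi, ao, bo) (ai', bi', ao, bo'))
           (\<lambda>(ai, bi, bo) (ai', bi', bo').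
              id_op ai ai' / of_nat (card {1..m}) * (case (bi, bo) of (bi, bo) \<Rightarrow> \<lambda>(bi', bo'). \<Sum>ai\<in>{1..m}. \<Sum>ao\<in>A.
                      Z (ai, bi, ao, bo) (ai, bi', ao, bo')) (bi', bo'))"
      unfolding eq_op_def using cA assms by (clarsimp simp: Zeq id_op_def c_def)
  next
    show "eq_op ({1..m} \<times> B \<times> A) (\<lambda>(ai, bi, ao) (ai', bi', ao'). \<Sum>bo\<in>{1..m}.
                      Z (ai, bi, ao, bo) (ai', bi', ao', bo))
           (\<lambda>(ai, bi, ao) (ai', bi', ao').
              id_op bi bi' / of_nat (card B) * (case (ai, ao) of (ai, ao) \<Rightarrow> \<lambda>(ai', ao'). \<Sum>bi\<in>B. \<Sum>bo\<in>{1..m}.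
                      Z (ai, bi, ao, bo) (ai', bi, ao', bo)) (ai', ao'))"
      unfolding eq_op_def using cA assms by (clarsimp simp: Zeq id_op_def c_def)
  qed
  then show ?thesis by (intro exI[of _ Z])
qed

section \<open>Tensor powers\<close>

lemma sys_power_0: "sys_power A 0 = {[]}"
  by (auto simp: sys_power_def)

lemma sys_power_Suc: "sys_power A (Suc n) = (\<lambda>(x, xs). x # xs) ` (A \<times> sys_power A n)"
  by (auto simp: sys_power_def length_Suc_conv image_iff)

lemma finite_sys_power: "finite A \<Longrightarrow> finite (sys_power A n)"
  by (induction n) (auto simp: sys_power_0 sys_power_Suc)

lemma sys_power_nonempty: "A \<noteq> {} \<Longrightarrow> sys_power A n \<noteq> {}"
  by (induction n) (auto simp: sys_power_0 sys_power_Suc)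

lemma sys_power_nth: "xs \<in> sys_power A n \<Longrightarrow> k < n \<Longrightarrow> xs ! k \<in> A"
  by (auto simp: sys_power_def subset_iff)

lemma sys_power_eq_iff:
  "xs \<in> sys_power A n \<Longrightarrow> ys \<in> sys_power A n \<Longrightarrow> xs = ys \<longleftrightarrow> (\<forall>k<n. xs ! k = ys ! k)"
  by (auto simp: sys_power_def list_eq_iff_nth_eq)

text \<open>Distributivity. The summand may depend on the position, which lets the induction shift
  it by one.\<close>

lemma sum_sys_power_prod:
  fixes f :: "nat \<Rightarrow> 'a \<Rightarrow> 'c :: comm_semiring_1"
  shows "(\<Sum>xs\<in>sys_power A n. \<Prod>k<n. f k (xs ! k)) = (\<Prod>k<n. \<Sum>x\<in>A. f k x)"
proof (induction n arbitrary: f)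
  case 0
  then show ?case by (simp add: sys_power_0)
next
  case (Suc n)
  have inj: "inj_on (\<lambda>(x, xs). x # xs) (A \<times> sys_power A n)"
    by (auto simp: inj_on_def)
  have "(\<Sum>xs\<in>sys_power A (Suc n). \<Prod>k<Suc n. f k (xs ! k)) =
      (\<Sum>x\<in>A. \<Sum>xs\<in>sys_power A n. f 0 x * (\<Prod>k<n. f (Suc k) (xs ! k)))"
    unfolding sys_power_Suc sum.reindex[OF inj]
    by (simp add: sum.cartesian_product' prod.lessThan_Suc_shift del: prod.lessThan_Suc)
  also have "\<dots> = (\<Sum>x\<in>A. f 0 x) * (\<Prod>k<n. \<Sum>x\<in>A. f (Suc k) x)"
    by (simp add: Suc.IH[of "\<lambda>k. f (Suc k)"] sum_distrib_left[symmetric] sum_distrib_right)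
  finally show ?case
    by (simp add: prod.lessThan_Suc_shift del: prod.lessThan_Suc)
qed

lemma prod_delta_sys_power:
  assumes "xs \<in> sys_power A n" "ys \<in> sys_power A n"
  shows "(\<Prod>k<n. if xs ! k = ys ! k then g k else 0) = (if xs = ys then \<Prod>k<n. g k else (0 :: complex))"
  using sys_power_eq_iff[OF assms] by (auto intro!: prod.cong)

section \<open>Tensor powers of operators\<close>

text \<open>Labels are pairs of lists rather than lists of pairs, so that they match
  \<open>sys_power A n \<times> sys_power B n\<close> and \<open>ptranspose\<close> acts on the
  whole output system.\<close>

definition bipartite_power :: "nat \<Rightarrow> ('a \<times> 'b) lop \<Rightarrow> ('a list \<times> 'b list) lop" where
  "bipartite_power n M = (\<lambda>(a, b) (a', b'). \<Prod>k<n. M (a ! k, b ! k) (a' ! k, b' ! k))"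

definition tensor_power :: "nat \<Rightarrow> 'b lop \<Rightarrow> 'b list lop" where
  "tensor_power n S = (\<lambda>b b'. \<Prod>k<n. S (b ! k) (b' ! k))"

lemma chan_power_eq:
  assumes "finite A"
  shows "chan_power A N n X = of_choi (sys_power A n) (bipartite_power n (choi A N)) X"
  unfolding chan_power_def of_choi_def bipartite_power_def
  by (intro ext sum.cong refl) (simp add: choi_entry assms sys_power_nth)

lemma choi_chan_power:
  assumes "finite A" "x \<in> sys_power A n \<times> sys_power B n" "y \<in> sys_power A n \<times> sys_power B n"
  shows "choi (sys_power A n) (chan_power A N n) x y = bipartite_power n (choi A N) x y"
proof -
  obtain a b a' b' where xy: "x = (a, b)" "y = (a', b')" by fastforce
  have a: "a \<in> sys_power A n" "a' \<in> sys_power A n" using assms xy by auto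
  have fin: "finite (sys_power A n)" using assms finite_sys_power by blast
  have "choi (sys_power A n) (chan_power A N n) x y =
     (\<Sum>c\<in>sys_power A n. \<Sum>c'\<in>sys_power A n. ketbra a a' c c' * bipartite_power n (choi A N) (c, b) (c', b'))"
    unfolding xy choi_entry[OF fin a] chan_power_eq[OF assms(1)] of_choi_def ..
  also have "\<dots> = (\<Sum>c\<in>sys_power A n. \<Sum>c'\<in>sys_power A n.
     if c' = a' then (if c = a then bipartite_power n (choi A N) (a, b) (a', b') else 0) else 0)"
    by (intro sum.cong refl) (auto simp: ketbra_def)
  also have "\<dots> = bipartite_power n (choi A N) x y"
    using fin a by (simp add: xy)
  finally show ?thesis .
qed

lemma ptranspose_bipartite_power: "ptranspose (bipartite_power n V) = bipartite_power n (ptranspose V)"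
  by (auto simp: ptranspose_def bipartite_power_def fun_eq_iff)

lemma bipartite_power_tensor_id:
  assumes "x \<in> sys_power A n \<times> sys_power B n" "y \<in> sys_power A n \<times> sys_power B n"
  shows "bipartite_power n (tensor_id S) x y = tensor_id (tensor_power n S) x y"
proof -
  obtain a b a' b' where [simp]: "x = (a, b)" "y = (a', b')" by fastforce
  show ?thesis
    using assms prod_delta_sys_power[of a A n a' "\<lambda>k. S (b ! k) (b' ! k)"]
    by (simp add: bipartite_power_def tensor_power_def tensor_id_def)
qed

lemma trace_tensor_power:
  "trace_op (sys_power B n) (tensor_power n S) = trace_op B S ^ n"
  using sum_sys_power_prod[of "\<lambda>_ b. S b b" n B] by (simp add: trace_op_def tensor_power_def)

section \<open>Feasible pairs and their tensor powers\<close>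

text \<open>The form of the output at \<open>v\<close> is the sum of all entries of an entrywise
  product of three positive operators: \<open>K\<close>, the pullback of \<open>\<rho>\<close>, and
  the rank-one operator of the conjugate of \<open>v\<close>.\<close>

lemma psd_op_of_choi:
  assumes "finite A" "finite B" "psd_op (A \<times> B) K" "psd_op A \<rho>"
  shows "psd_op B (of_choi A K \<rho>)"
  unfolding psd_op_iff
proof (intro conjI ballI allI)
  fix b b' assume "b \<in> B" "b' \<in> B"
  then have "cnj (of_choi A K \<rho> b' b) = (\<Sum>a\<in>A. \<Sum>a'\<in>A. \<rho> a' a * K (a', b) (a, b'))"
    unfolding of_choi_def cnj_sum complex_cnj_mult
    using psd_op_hermD[OF assms(4)] psd_op_hermD[OF assms(3)] by (intro sum.cong refl) auto
  also have "\<dots> = of_choi A K \<rho> b b'"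
    unfolding of_choi_def by (rule sum.swap)
  finally show "cnj (of_choi A K \<rho> b' b) = of_choi A K \<rho> b b'" .
next
  fix v
  have fin: "finite (A \<times> B)" using assms by auto
  have "psd_op (A \<times> B) (\<lambda>x y. \<rho> (fst x) (fst y) * (cnj (v (snd x)) * cnj (cnj (v (snd y)))) * K x y)"
    using assms fin by (intro psd_op_schur psd_op_rank_one psd_op_reindex[of _ A \<rho> fst]) auto
  from psd_op_sum_ge_0[OF this]
  have "0 \<le> Re (\<Sum>a\<in>A. \<Sum>b\<in>B. \<Sum>a'\<in>A. \<Sum>b'\<in>B. \<rho> a a' * (cnj (v b) * v b') * K (a, b) (a', b'))"
    unfolding sum.cartesian_product' by simp
  also have "(\<Sum>a\<in>A. \<Sum>b\<in>B. \<Sum>a'\<in>A. \<Sum>b'\<in>B. \<rho> a a' * (cnj (v b) * v b') * K (a, b) (a', b')) =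
    (\<Sum>b\<in>B. \<Sum>a\<in>A. \<Sum>b'\<in>B. \<Sum>a'\<in>A. \<rho> a a' * (cnj (v b) * v b') * K (a, b) (a', b'))"
    by (subst sum.swap, intro sum.cong refl, subst sum.swap) simp
  also have "\<dots> = (\<Sum>b\<in>B. \<Sum>b'\<in>B. \<Sum>a\<in>A. \<Sum>a'\<in>A. \<rho> a a' * (cnj (v b) * v b') * K (a, b) (a', b'))"
    by (intro sum.cong refl sum.swap)
  also have "\<dots> = quad_form B (of_choi A K \<rho>) v"
    unfolding quad_form_def of_choi_def sum_distrib_left sum_distrib_right
    by (intro sum.cong refl) (simp add: mult_ac)
  finally show "0 \<le> Re (quad_form B (of_choi A K \<rho>) v)" .
qed

text \<open>The constraints of \<open>zeta\<close> as positivity of differences, together with J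
  \<ge> 0, on which the monotonicity of products and the positivity of outputs rely.\<close>

locale zeta_feasible =
  fixes A :: "'a set" and B :: "'b set" and J V :: "('a \<times> 'b) lop" and S :: "'b lop"
  assumes fin: "finite A" "finite B"
    and J: "psd_op (A \<times> B) J"
    and VJ: "psd_op (A \<times> B) (\<lambda>x y. V x y - J x y)"
    and SV: "psd_op (A \<times> B) (\<lambda>x y. tensor_id S x y - ptranspose V x y)"
    and SV': "psd_op (A \<times> B) (\<lambda>x y. tensor_id S x y + ptranspose V x y)"
begin

lemma psd_op_pullback_factor:
  assumes "psd_op (A \<times> B) M" "k < n"
  shows "psd_op (sys_power A n \<times> sys_power B n) (\<lambda>(a, b) (a', b'). M (a ! k, b ! k) (a' ! k, b' ! k))"
proof -
  have "psd_op (sys_power A n \<times> sys_power B n)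
     (\<lambda>x y. M ((\<lambda>(a, b). (a ! k, b ! k)) x) ((\<lambda>(a, b). (a ! k, b ! k)) y))"
    using assms fin
    by (intro psd_op_reindex[OF _ _ assms(1)]) (auto simp: finite_sys_power sys_power_nth)
  then show ?thesis by (rule psd_op_cong) auto
qed

text \<open>A tensor power is an entrywise product of \<open>n\<close> pulled-back operators. Hence
  \<open>psd_op_prod_mono\<close> carries over V \<ge> J, and \<open>psd_op_prod_abs\<close> the
  two-sided bound by \<open>S\<close>.\<close>

lemma bipartite_power_feasible:
  "zeta_feasible (sys_power A n) (sys_power B n) (bipartite_power n J) (bipartite_power n V) (tensor_power n S)"
proof
  let ?I = "sys_power A n \<times> sys_power B n"
  have finI: "finite ?I" using fin by (auto simp: finite_sys_power)
  show "finite (sys_power A n)" "finite (sys_power B n)" using fin by (auto simp: finite_sys_power)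
  note factor = psd_op_pullback_factor[of _ _ n]
  have "psd_op ?I (\<lambda>x y. \<Prod>k<n. (\<lambda>(a, b) (a', b'). J (a ! k, b ! k) (a' ! k, b' ! k)) x y)"
    using factor[OF J] by (intro psd_op_prod finI) auto
  then show "psd_op ?I (bipartite_power n J)"
    by (rule psd_op_cong) (auto simp: bipartite_power_def)
  have "psd_op ?I (\<lambda>x y. (\<Prod>k<n. (\<lambda>(a, b) (a', b'). V (a ! k, b ! k) (a' ! k, b' ! k)) x y) -
     (\<Prod>k<n. (\<lambda>(a, b) (a', b'). J (a ! k, b ! k) (a' ! k, b' ! k)) x y))"
    using factor[OF J] factor[OF VJ]
    by (intro psd_op_prod_mono finI) (auto simp: split_def)
  then show "psd_op ?I (\<lambda>x y. bipartite_power n V x y - bipartite_power n J x y)"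
    by (rule psd_op_cong) (auto simp: bipartite_power_def)
  have *: "psd_op ?I (\<lambda>x y. (\<Prod>k<n. (\<lambda>(a, b) (a', b'). tensor_id S (a ! k, b ! k) (a' ! k, b' ! k)) x y) -
     (\<Prod>k<n. (\<lambda>(a, b) (a', b'). ptranspose V (a ! k, b ! k) (a' ! k, b' ! k)) x y)) \<and>
     psd_op ?I (\<lambda>x y. (\<Prod>k<n. (\<lambda>(a, b) (a', b'). tensor_id S (a ! k, b ! k) (a' ! k, b' ! k)) x y) +
     (\<Prod>k<n. (\<lambda>(a, b) (a', b'). ptranspose V (a ! k, b ! k) (a' ! k, b' ! k)) x y))"
    using factor[OF SV] factor[OF SV']
    by (intro psd_op_prod_abs finI) (auto simp: split_def)
  have e: "(\<Prod>k<n. (\<lambda>(a, b) (a', b'). tensor_id S (a ! k, b ! k) (a' ! k, b' ! k)) x y) = tensor_id (tensor_power n S) x y"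
    if "x \<in> ?I" "y \<in> ?I" for x y
    using bipartite_power_tensor_id[OF that, of S] by (simp add: bipartite_power_def split_def)
  show "psd_op ?I (\<lambda>x y. tensor_id (tensor_power n S) x y - ptranspose (bipartite_power n V) x y)"
    by (rule psd_op_cong[OF conjunct1[OF *]], unfold e ptranspose_bipartite_power)
      (simp add: bipartite_power_def split_def)
  show "psd_op ?I (\<lambda>x y. tensor_id (tensor_power n S) x y + ptranspose (bipartite_power n V) x y)"
    by (rule psd_op_cong[OF conjunct2[OF *]], unfold e ptranspose_bipartite_power)
      (simp add: bipartite_power_def split_def)
qed

lemma of_choi_le:
  assumes "density_op A \<rho>"
  shows "psd_op B (\<lambda>b b'. S b' b - of_choi A J \<rho> b b')"
proof -
  have \<rho>: "psd_op A \<rho>" and tr: "trace_op A \<rho> = 1" using assms by (auto simp: density_op_def)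
  have "psd_op B (\<lambda>b b'. S b b' - of_choi A (ptranspose V) \<rho> b b')"
  proof (rule psd_op_cong[OF psd_op_of_choi[OF fin SV \<rho>]])
    fix b b' assume "b \<in> B" "b' \<in> B"
    have "of_choi A (tensor_id S) \<rho> b b' = (\<Sum>a\<in>A. \<Sum>a'\<in>A. if a' = a then \<rho> a a * S b b' else 0)"
      unfolding of_choi_def by (intro sum.cong refl) (auto simp: tensor_id_def)
    also have "\<dots> = S b b'"
      using fin tr by (simp add: trace_op_def sum_distrib_right[symmetric])
    finally show "of_choi A (\<lambda>x y. tensor_id S x y - ptranspose V x y) \<rho> b b' = S b b' - of_choi A (ptranspose V) \<rho> b b'"
      by (simp add: of_choi_def right_diff_distrib sum_subtractf)
  qed
  \<comment> \<open>Transposing the output undoes the partial transpose, as \<open>\<rho>\<close>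
    acts on \<open>A\<close> alone.\<close>
  then have "psd_op B (\<lambda>b b'. S b' b - of_choi A (ptranspose V) \<rho> b' b)"
    by (rule psd_op_transpose)
  then have "psd_op B (\<lambda>b b'. S b' b - of_choi A V \<rho> b b')"
    by (simp add: of_choi_def ptranspose_def)
  from psd_op_add[OF this psd_op_of_choi[OF fin VJ \<rho>]] show ?thesis
    by (rule psd_op_cong) (simp add: of_choi_def right_diff_distrib sum_subtractf)
qed

end

section \<open>Spectral theorem for Hermitian operators\<close>

definition dag :: "complex mat \<Rightarrow> complex mat" where
  "dag U = mat (dim_col U) (dim_row U) (\<lambda>(i, j). cnj (U $$ (j, i)))"

lemma dag_dims [simp]: "dim_row (dag U) = dim_col U" "dim_col (dag U) = dim_row U"
  by (simp_all add: dag_def)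

lemma dag_carrier: "U \<in> carrier_mat n m \<Longrightarrow> dag U \<in> carrier_mat m n"
  by (auto simp: dag_def)

lemma dag_index [simp]: "i < dim_col U \<Longrightarrow> j < dim_row U \<Longrightarrow> dag U $$ (i, j) = cnj (U $$ (j, i))"
  by (simp add: dag_def)

lemma dag_mult:
  assumes "U \<in> carrier_mat n m" "W \<in> carrier_mat m p"
  shows "dag (U * W) = dag W * dag U"
  using assms by (intro eq_matI) (auto simp: scalar_prod_def mult.commute)

lemma dag_dag: "dag (dag U) = U"
  by (intro eq_matI) auto

lemma dag_four_block_diag:
  assumes "P \<in> carrier_mat 1 1" "Q \<in> carrier_mat n n"
  shows "dag (four_block_mat P (0\<^sub>m 1 n) (0\<^sub>m n 1) Q) = four_block_mat (dag P) (0\<^sub>m 1 n) (0\<^sub>m n 1) (dag Q)"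
  using assms by (intro eq_matI) auto

lemma mult_four_block_diag:
  fixes P P' Q Q' :: "complex mat"
  assumes "P \<in> carrier_mat 1 1" "Q \<in> carrier_mat n n" "P' \<in> carrier_mat 1 1" "Q' \<in> carrier_mat n n"
  shows "four_block_mat P (0\<^sub>m 1 n) (0\<^sub>m n 1) Q * four_block_mat P' (0\<^sub>m 1 n) (0\<^sub>m n 1) Q' =
    four_block_mat (P * P') (0\<^sub>m 1 n) (0\<^sub>m n 1) (Q * Q')"
  using assms by (subst mult_four_block_mat[of _ 1 1 _ n _ n _ _ 1 _ n]) auto

text \<open>Complete \<open>v\<close> to a basis, orthogonalize it and normalize the columns.
  Gram-Schmidt leaves the first vector unchanged, so the first column remains a multiple of
  \<open>v\<close>.\<close>

lemma unitary_with_first_column: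
  fixes v :: "complex vec"
  assumes v: "v \<in> carrier_vec n" "v \<noteq> 0\<^sub>v n"
  obtains W c where "W \<in> carrier_mat n n" "dag W * W = 1\<^sub>m n" "col W 0 = c \<cdot>\<^sub>v v"
proof -
  have n: "n \<noteq> 0" using v by auto
  define b where "b = basis_completion v"
  define ws where "ws = gram_schmidt n b"
  interpret cof_vec_space n "TYPE(complex)" .
  from basis_completion[OF v, folded b_def]
  have dist_b: "distinct b" and indep: "\<not> lin_dep (set b)" and b: "set b \<subseteq> carrier_vec n"
    and hdb: "hd b = v" and len_b: "length b = n" by auto
  from hdb len_b n obtain vs where bv: "b = v # vs" by (cases b) auto
  from gram_schmidt_result[OF b dist_b indep refl, folded ws_def]
  have ws: "set ws \<subseteq> carrier_vec n" "corthogonal ws" "length ws = n"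
    by (auto simp: len_b)
  from gram_schmidt_hd[OF v(1), of vs, folded bv] have hdws: "hd ws = v" unfolding ws_def .
  have ws0: "ws ! 0 = v" using hdws ws(3) n by (cases ws) auto
  have wsc: "ws ! j \<in> carrier_vec n" if "j < n" for j using ws that by auto
  define nrm where "nrm = (\<lambda>j. sqrt (\<Sum>i<n. (cmod ((ws ! j) $ i))\<^sup>2))"
  have ip: "(\<Sum>i<n. (ws ! j) $ i * cnj ((ws ! k) $ i)) = ws ! j \<bullet>c ws ! k" if "j < n" "k < n" for j k
    using wsc[OF that(1)] wsc[OF that(2)] by (simp add: scalar_prod_def atLeast0LessThan)
  have nn: "complex_of_real (nrm j) * complex_of_real (nrm j) = ws ! j \<bullet>c ws ! j" if "j < n" for j
  proof -
    have "nrm j * nrm j = (\<Sum>i<n. (cmod ((ws ! j) $ i))\<^sup>2)"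
      unfolding nrm_def by (simp add: sum_nonneg)
    then have "complex_of_real (nrm j) * complex_of_real (nrm j) = complex_of_real (\<Sum>i<n. (cmod ((ws ! j) $ i))\<^sup>2)"
      by (metis of_real_mult)
    also have "\<dots> = (\<Sum>i<n. (ws ! j) $ i * cnj ((ws ! j) $ i))"
      by (simp only: of_real_sum complex_norm_square)
    finally show ?thesis using ip[OF that that] by simp
  qed
  have orth: "ws ! j \<bullet>c ws ! k = 0 \<longleftrightarrow> j \<noteq> k" if "j < n" "k < n" for j k
    using corthogonalD[OF ws(2)] that ws(3) by simp
  define W where "W = mat n n (\<lambda>(i, j). (ws ! j) $ i / complex_of_real (nrm j))"
  have W: "W \<in> carrier_mat n n" by (simp add: W_def)
  have "dag W * W = 1\<^sub>m n"
  proof (rule eq_matI)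
    fix i j assume "i < dim_row (1\<^sub>m n :: complex mat)" "j < dim_col (1\<^sub>m n :: complex mat)"
    then have ij: "i < n" "j < n" by auto
    have "(dag W * W) $$ (i, j) = (\<Sum>k<n. cnj ((ws ! i) $ k / complex_of_real (nrm i)) * ((ws ! j) $ k / complex_of_real (nrm j)))"
      using ij by (simp add: W_def scalar_prod_def dag_def atLeast0LessThan)
    also have "\<dots> = (\<Sum>k<n. (ws ! j) $ k * cnj ((ws ! i) $ k)) / (complex_of_real (nrm i) * complex_of_real (nrm j))"
      unfolding sum_divide_distrib by (intro sum.cong refl) simp
    also have "\<dots> = (if i = j then 1 else 0)"
      using ip[OF ij(2,1)] orth[OF ij(2,1)] nn[OF ij(1)] orth[OF ij(1) ij(1)] by auto
    finally show "(dag W * W) $$ (i, j) = 1\<^sub>m n $$ (i, j)"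
      using ij by simp
  qed (auto simp: W_def)
  moreover have "col W 0 = (1 / complex_of_real (nrm 0)) \<cdot>\<^sub>v v"
    using v n by (intro eq_vecI) (auto simp: W_def ws0)
  ultimately show ?thesis using that[OF W] by blast
qed

text \<open>Deflation: conjugation with a unitary whose first column is an eigenvector isolates a 1
  x 1 block, since self-adjointness turns the zeros below the corner into zeros beside it. The
  induction hypothesis diagonalizes the other block.\<close>

lemma hermitian_diagonalization:
  fixes A :: "complex mat"
  assumes "A \<in> carrier_mat n n" "dag A = A"
  shows "\<exists>U D. U \<in> carrier_mat n n \<and> D \<in> carrier_mat n n \<and> diagonal_mat D \<and> dag U * U = 1\<^sub>m n \<and> A = U * D * dag U"
  using assms
proof (induction n arbitrary: A)
  case 0
  then show ?case
    by (intro exI[of _ A] conjI) (auto simp: diagonal_mat_def intro!: eq_matI)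
next
  case (Suc n A)
  let ?N = "Suc n"
  note A = Suc.prems(1)
  obtain as where as: "char_poly A = (\<Prod>a\<leftarrow>as. [:- a, 1:])" "length as = ?N"
    using char_poly_factorized[OF A] by blast
  then obtain e as' where "as = e # as'" by (cases as) auto
  then have "poly (char_poly A) e = 0" using as by simp
  then have "eigenvalue A e" using eigenvalue_root_char_poly[OF A] by simp
  then obtain v where "eigenvector A v e" by (auto simp: eigenvalue_def)
  then have v: "v \<in> carrier_vec ?N" "v \<noteq> 0\<^sub>v ?N" "A *\<^sub>v v = e \<cdot>\<^sub>v v"
    using A by (auto simp: eigenvector_def)
  obtain W c where W: "W \<in> carrier_mat ?N ?N" and WW: "dag W * W = 1\<^sub>m ?N" and W0: "col W 0 = c \<cdot>\<^sub>v v"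
    using unitary_with_first_column[OF v(1,2)] .
  have dW: "dag W \<in> carrier_mat ?N ?N" using W by (rule dag_carrier)
  have WW': "W * dag W = 1\<^sub>m ?N"
    using mat_mult_left_right_inverse[OF dW W WW] .
  define A' where "A' = dag W * A * W"
  have A': "A' \<in> carrier_mat ?N ?N" using W A dW by (auto simp: A'_def)
  have A'h: "dag A' = A'"
    unfolding A'_def using A W dW Suc.prems(2)
    by (simp add: dag_mult[of _ ?N ?N _ ?N] dag_dag assoc_mult_mat[of _ ?N ?N _ ?N _ ?N])
  have AW0: "col (A * W) 0 = e \<cdot>\<^sub>v col W 0"
  proof -
    have "col (A * W) 0 = A *\<^sub>v col W 0" by (rule col_mult2[OF A W]) simp
    also have "\<dots> = c \<cdot>\<^sub>v (A *\<^sub>v v)" unfolding W0 using A v by (simp add: mult_mat_vec)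
    also have "\<dots> = e \<cdot>\<^sub>v col W 0" unfolding W0 v(3) by (simp add: smult_smult_assoc mult.commute)
    finally show ?thesis .
  qed
  \<comment> \<open>The first column of \<open>A * W\<close> is \<open>e\<close> times that of
    \<open>W\<close>, so orthonormality of the columns of \<open>W\<close> leaves only the
    corner.\<close>
  have A'0: "A' $$ (i, 0) = (if i = 0 then e else 0)" if "i < ?N" for i
  proof -
    have "A' $$ (i, 0) = row (dag W) i \<bullet> col (A * W) 0"
      unfolding A'_def using that W A dW by (simp add: assoc_mult_mat[of _ ?N ?N _ ?N _ ?N])
    also have "\<dots> = e * (row (dag W) i \<bullet> col W 0)"
      unfolding AW0 using dW col_carrier_vec[OF _ W, of 0] that
      by (intro scalar_prod_smult_distrib[of _ ?N]) (auto simp del: col_dim)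
    also have "row (dag W) i \<bullet> col W 0 = (dag W * W) $$ (i, 0)"
      using that W by simp
    finally show ?thesis unfolding WW using that by simp
  qed
  have A'0': "A' $$ (0, i) = (if i = 0 then e else 0)" if "i < ?N" "i \<noteq> 0" for i
  proof -
    have "A' $$ (0, i) = dag A' $$ (0, i)" using A'h by simp
    also have "\<dots> = cnj (A' $$ (i, 0))" using A' that by simp
    finally show ?thesis using A'0[OF that(1)] that by simp
  qed
  define A3 where "A3 = mat n n (\<lambda>(i, j). A' $$ (Suc i, Suc j))"
  define E where "E = mat 1 1 (\<lambda>_. e)"
  have A3: "A3 \<in> carrier_mat n n" and E: "E \<in> carrier_mat 1 1" by (auto simp: A3_def E_def)
  have blk: "A' = four_block_mat E (0\<^sub>m 1 n) (0\<^sub>m n 1) A3"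
    using A' A'0 A'0' by (intro eq_matI) (auto simp: A3_def E_def)
  have "dag A3 = A3"
  proof (rule eq_matI)
    fix i j assume "i < dim_row A3" "j < dim_col A3"
    then have ij: "i < n" "j < n" by (auto simp: A3_def)
    have "cnj (A' $$ (Suc j, Suc i)) = dag A' $$ (Suc i, Suc j)" using A' ij by simp
    then show "dag A3 $$ (i, j) = A3 $$ (i, j)" using ij A'h by (simp add: A3_def)
  qed (auto simp: A3_def)
  from Suc.IH[OF A3 this] obtain U3 D3 where U3: "U3 \<in> carrier_mat n n" and D3: "D3 \<in> carrier_mat n n"
    "diagonal_mat D3" and UU3: "dag U3 * U3 = 1\<^sub>m n" and A3eq: "A3 = U3 * D3 * dag U3" by blast
  have dU3: "dag U3 \<in> carrier_mat n n" using U3 by (rule dag_carrier)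
  define U' where "U' = four_block_mat (1\<^sub>m 1) (0\<^sub>m 1 n) (0\<^sub>m n 1) U3"
  define D where "D = four_block_mat E (0\<^sub>m 1 n) (0\<^sub>m n 1) D3"
  have d1: "dag (1\<^sub>m 1) = 1\<^sub>m 1" by (intro eq_matI) auto
  have dU': "dag U' = four_block_mat (1\<^sub>m 1) (0\<^sub>m 1 n) (0\<^sub>m n 1) (dag U3)"
    unfolding U'_def using U3 by (subst dag_four_block_diag) (auto simp: d1)
  have U': "U' \<in> carrier_mat ?N ?N" and D: "D \<in> carrier_mat ?N ?N"
    using U3 D3 E by (auto simp: U'_def D_def)
  have dU'c: "dag U' \<in> carrier_mat ?N ?N" using U' by (rule dag_carrier)
  have UU': "dag U' * U' = 1\<^sub>m ?N"
  proof -
    have "dag U' * U' = four_block_mat (1\<^sub>m 1 * 1\<^sub>m 1) (0\<^sub>m 1 n) (0\<^sub>m n 1) (dag U3 * U3)"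
      unfolding dU' unfolding U'_def by (rule mult_four_block_diag) (use U3 dU3 in auto)
    also have "1\<^sub>m 1 * 1\<^sub>m 1 = (1\<^sub>m 1 :: complex mat)" by (rule left_mult_one_mat[OF one_carrier_mat])
    finally show ?thesis unfolding UU3 four_block_one_mat by simp
  qed
  have "A' = U' * D * dag U'"
  proof -
    have "U' * D = four_block_mat (1\<^sub>m 1 * E) (0\<^sub>m 1 n) (0\<^sub>m n 1) (U3 * D3)"
      unfolding U'_def D_def by (rule mult_four_block_diag) (use U3 D3 E in auto)
    also have "1\<^sub>m 1 * E = E" using E by (rule left_mult_one_mat)
    finally have "U' * D * dag U' = four_block_mat (E * 1\<^sub>m 1) (0\<^sub>m 1 n) (0\<^sub>m n 1) (U3 * D3 * dag U3)"
      unfolding dU' by (simp only:) (rule mult_four_block_diag, use U3 dU3 D3 E in auto)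
    also have "E * 1\<^sub>m 1 = E" using E by (rule right_mult_one_mat)
    finally show ?thesis unfolding blk A3eq by simp
  qed
  moreover have "A = W * A' * dag W"
  proof -
    have "W * A' * dag W = (W * dag W) * A * (W * dag W)"
      unfolding A'_def using A W dW by (simp add: assoc_mult_mat[of _ ?N ?N _ ?N _ ?N])
    then show ?thesis using A by (simp add: WW')
  qed
  ultimately have "A = (W * U') * D * dag (W * U')"
    using W U' D dW dU'c
    by (simp add: dag_mult[of _ ?N ?N _ ?N] assoc_mult_mat[of _ ?N ?N _ ?N _ ?N])
  moreover have "dag (W * U') * (W * U') = 1\<^sub>m ?N"
  proof -
    have "dag (W * U') * (W * U') = dag U' * ((dag W * W) * U')"
      using W U' dW dU'c by (simp add: dag_mult[of _ ?N ?N _ ?N] assoc_mult_mat[of _ ?N ?N _ ?N _ ?N])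
    then show ?thesis using U' by (simp add: WW UU')
  qed
  moreover have "diagonal_mat D"
    using D3 E unfolding diagonal_mat_def D_def by auto
  ultimately show ?case using W U' D by (intro exI[of _ "W * U'"] exI[of _ D]) auto
qed

section \<open>Spectral decompositions over label sets\<close>

text \<open>The matrix theorem, carried over along the enumeration of \<open>I\<close> that
  \<open>vn_entropy\<close> uses. Both orthonormality and completeness are recorded, so that the
  squared moduli of the entries sum to one in either index.\<close>

lemma hermitian_op_spectral:
  assumes fin: "finite I" and M: "hermitian_op I M"
  obtains u :: "nat \<Rightarrow> 'a \<Rightarrow> complex" and l :: "nat \<Rightarrow> complex"
  where "\<And>j k. j < card I \<Longrightarrow> k < card I \<Longrightarrow> (\<Sum>i\<in>I. cnj (u j i) * u k i) = (if j = k then 1 else 0)"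
    and "\<And>i i'. i \<in> I \<Longrightarrow> i' \<in> I \<Longrightarrow> (\<Sum>k<card I. u k i * cnj (u k i')) = (if i = i' then 1 else 0)"
    and "\<And>i i'. i \<in> I \<Longrightarrow> i' \<in> I \<Longrightarrow> M i i' = (\<Sum>k<card I. l k * (u k i * cnj (u k i')))"
    and "vn_entropy I M = - (\<Sum>k<card I. Re (l k) * log 2 (Re (l k)))"
proof -
  let ?n = "card I" and ?g = "from_nat_into I"
  have herm: "cnj (M j i) = M i j" if "i \<in> I" "j \<in> I" for i j
    using M that by (auto simp: hermitian_op_def eq_op_def adj_op_def)
  define A where "A = mat_of_op I M"
  have bij: "bij_betw ?g {..<?n} I" using fin by (rule bij_betw_from_nat_into_finite)
  then have gI: "?g k \<in> I" if "k < ?n" for k using that by (auto simp: bij_betw_def)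
  have A: "A \<in> carrier_mat ?n ?n" by (simp add: A_def mat_of_op_def)
  have "dag A = A"
    by (rule eq_matI) (auto simp: A_def mat_of_op_def herm gI)
  from hermitian_diagonalization[OF A this] obtain U D where
    U: "U \<in> carrier_mat ?n ?n" and D: "D \<in> carrier_mat ?n ?n" "diagonal_mat D"
    and UU: "dag U * U = 1\<^sub>m ?n" and AU: "A = U * D * dag U" by blast
  have dU: "dag U \<in> carrier_mat ?n ?n" using U by (rule dag_carrier)
  have UU': "U * dag U = 1\<^sub>m ?n" using mat_mult_left_right_inverse[OF dU U UU] .
  define h where "h = the_inv_into {..<?n} ?g"
  have h: "h i < ?n" "?g (h i) = i" if "i \<in> I" for i
    using that bij the_inv_into_into[of ?g "{..<?n}" i "{..<?n}"] f_the_inv_into_f[of ?g "{..<?n}" i]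
    by (auto simp: h_def bij_betw_def)
  have hg: "h (?g k) = k" if "k < ?n" for k
    using bij that the_inv_into_f_f[of ?g "{..<?n}" k] by (auto simp: h_def bij_betw_def)
  define u where "u = (\<lambda>k i. U $$ (h i, k))"
  define l where "l = (\<lambda>k. D $$ (k, k))"
  show ?thesis
  proof (rule that[of u l])
    fix j k assume jk: "j < ?n" "k < ?n"
    have "(\<Sum>i\<in>I. cnj (u j i) * u k i) = (\<Sum>r<?n. cnj (U $$ (r, j)) * U $$ (r, k))"
      unfolding sum.reindex_bij_betw[OF bij, symmetric] by (intro sum.cong refl) (simp add: u_def hg)
    also have "\<dots> = (dag U * U) $$ (j, k)"
      using U jk by (simp add: scalar_prod_def atLeast0LessThan)
    finally show "(\<Sum>i\<in>I. cnj (u j i) * u k i) = (if j = k then 1 else 0)"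
      using UU jk by simp
  next
    fix i i' assume i: "i \<in> I" "i' \<in> I"
    have "(\<Sum>k<?n. u k i * cnj (u k i')) = (U * dag U) $$ (h i, h i')"
      using U h(1)[OF i(1)] h(1)[OF i(2)] by (simp add: scalar_prod_def atLeast0LessThan u_def)
    also have "\<dots> = (if h i = h i' then 1 else 0)" using UU' h i by simp
    also have "h i = h i' \<longleftrightarrow> i = i'" using h i by metis
    finally show "(\<Sum>k<?n. u k i * cnj (u k i')) = (if i = i' then 1 else 0)" .
  next
    fix i i' assume i: "i \<in> I" "i' \<in> I"
    have hi: "h i < ?n" "h i' < ?n" using h i by auto
    have UD: "(U * D) $$ (h i, k) = U $$ (h i, k) * l k" if "k < ?n" for k
    proof -
      have "(U * D) $$ (h i, k) = (\<Sum>r<?n. U $$ (h i, r) * D $$ (r, k))"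
        using U D hi that by (simp add: scalar_prod_def atLeast0LessThan)
      also have "\<dots> = (\<Sum>r<?n. if r = k then U $$ (h i, k) * l k else 0)"
        using D that by (intro sum.cong refl) (auto simp: l_def diagonal_mat_def)
      finally show ?thesis using that by simp
    qed
    have mult: "(X * dag U) $$ (h i, h i') = (\<Sum>k<?n. X $$ (h i, k) * dag U $$ (k, h i'))"
      if "X \<in> carrier_mat ?n ?n" for X
      using carrier_matD[OF that] carrier_matD[OF dU] hi
      by (simp add: index_mult_mat scalar_prod_def atLeast0LessThan del: dag_index dag_dims)

    have "M i i' = A $$ (h i, h i')" using h i by (simp add: A_def mat_of_op_def)
    also have "\<dots> = (\<Sum>k<?n. (U * D) $$ (h i, k) * dag U $$ (k, h i'))"
      unfolding AU by (rule mult) (use U D in auto)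
    also have "\<dots> = (\<Sum>k<?n. l k * (u k i * cnj (u k i')))"
      using U hi by (intro sum.cong refl) (simp add: UD u_def mult_ac)
    finally show "M i i' = (\<Sum>k<?n. l k * (u k i * cnj (u k i')))" .
  next
    \<comment> \<open>Similarity to a diagonal matrix identifies the roots of the characteristic
      polynomial, with multiplicity, with the numbers \<open>l k\<close>.\<close>
    have "similar_mat A D"
      by (rule similar_matI[of _ _ U "dag U" ?n]) (use A D U dU UU UU' AU in auto)
    then have "char_poly A = char_poly D" by (rule char_poly_similar)
    also have "\<dots> = (\<Prod>a\<leftarrow>diag_mat D. [:- a, 1:])"
      using D by (intro char_poly_upper_triangular[of _ ?n]) (auto simp: diagonal_mat_def upper_triangular_def)
    also have "\<dots> = (\<Prod>k<?n. [:- l k, 1:])"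
      using D prod.distinct_set_conv_list[of "[0..<?n]" "\<lambda>k. [:- l k, 1:]"]
      by (simp add: diag_mat_def l_def atLeast0LessThan o_def)
    finally have "proots (char_poly A) = (\<Sum>k<?n. {#l k#})"
      by (simp add: proots_prod)
    moreover have "(\<Sum>x\<in>#(\<Sum>k\<in>K. {#l k#}). f x) = (\<Sum>k\<in>K. f (l k))"
      for K and f :: "complex \<Rightarrow> real"
      by (induction K rule: infinite_finite_induct) auto
    ultimately show "vn_entropy I M = - (\<Sum>k<?n. Re (l k) * log 2 (Re (l k)))"
      unfolding vn_entropy_def A_def[symmetric] by simp
  qed
qed

section \<open>Entropy and Holevo information\<close>

definition diag_op :: "('a \<Rightarrow> real) \<Rightarrow> 'a lop" where
  "diag_op s = (\<lambda>i j. if i = j then complex_of_real (s i) else 0)"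

lemma quad_form_diag_op:
  assumes "finite I"
  shows "quad_form I (diag_op s) v = complex_of_real (\<Sum>i\<in>I. s i * (cmod (v i))\<^sup>2)"
proof -
  have "quad_form I (diag_op s) v = (\<Sum>i\<in>I. \<Sum>j\<in>I. if j = i then complex_of_real (s i) * (v i * cnj (v i)) else 0)"
    unfolding quad_form_def by (intro sum.cong refl) (auto simp: diag_op_def)
  then show ?thesis
    using assms by (simp add: complex_norm_square[symmetric] del: of_real_power)
qed

lemma psd_op_hermitian: "psd_op I M \<Longrightarrow> hermitian_op I M"
  by (simp add: psd_op_def)

text \<open>\<open>p k i\<close> is the squared modulus of entry \<open>i\<close> of the
  \<open>k\<close>-th eigenvector; these weights form a doubly stochastic array. The last property
  comes from testing M \<le> diag s at the eigenvector divided by \<open>s\<close>.\<close>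

lemma psd_op_spectral:
  assumes fin: "finite I" and psd: "psd_op I M"
  obtains l :: "nat \<Rightarrow> real" and p :: "nat \<Rightarrow> 'a \<Rightarrow> real"
  where "\<And>k. k < card I \<Longrightarrow> 0 \<le> l k" "\<And>k i. 0 \<le> p k i"
    "\<And>k. k < card I \<Longrightarrow> (\<Sum>i\<in>I. p k i) = 1"
    "\<And>i. i \<in> I \<Longrightarrow> (\<Sum>k<card I. p k i) = 1"
    "\<And>i. i \<in> I \<Longrightarrow> Re (M i i) = (\<Sum>k<card I. l k * p k i)"
    "vn_entropy I M = - (\<Sum>k<card I. l k * log 2 (l k))"
    "\<And>s k. (\<And>i. i \<in> I \<Longrightarrow> 0 < s i) \<Longrightarrow> psd_op I (\<lambda>i j. diag_op s i j - M i j) \<Longrightarrow> k < card I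
       \<Longrightarrow> l k * (\<Sum>i\<in>I. p k i / s i) \<le> 1"
proof -
  obtain u l where
    orth: "\<And>j k. j < card I \<Longrightarrow> k < card I \<Longrightarrow> (\<Sum>i\<in>I. cnj (u j i) * u k i) = (if j = k then 1 else 0)"
    and compl: "\<And>i i'. i \<in> I \<Longrightarrow> i' \<in> I \<Longrightarrow> (\<Sum>k<card I. u k i * cnj (u k i')) = (if i = i' then 1 else 0)"
    and M: "\<And>i i'. i \<in> I \<Longrightarrow> i' \<in> I \<Longrightarrow> M i i' = (\<Sum>k<card I. l k * (u k i * cnj (u k i')))"
    and ent: "vn_entropy I M = - (\<Sum>k<card I. Re (l k) * log 2 (Re (l k)))"
    by (rule hermitian_op_spectral[OF fin psd_op_hermitian[OF psd]]) blast
  define p where "p = (\<lambda>k i. (cmod (u k i))\<^sup>2)"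
  have p: "complex_of_real (p k i) = u k i * cnj (u k i)" for k i
    unfolding p_def by (rule complex_norm_square)
  have quad: "Re (quad_form I M w) = (\<Sum>k<card I. Re (l k) * (cmod (\<Sum>i\<in>I. cnj (w i) * u k i))\<^sup>2)" for w
  proof -
    have "quad_form I M w = (\<Sum>i\<in>I. \<Sum>j\<in>I. \<Sum>k<card I. l k * (cnj (w i) * (u k i * cnj (u k j)) * w j))"
      unfolding quad_form_def by (intro sum.cong refl) (simp add: M sum_distrib_left sum_distrib_right mult_ac)
    also have "\<dots> = (\<Sum>i\<in>I. \<Sum>k<card I. \<Sum>j\<in>I. l k * (cnj (w i) * (u k i * cnj (u k j)) * w j))"
      by (intro sum.cong refl sum.swap)
    also have "\<dots> = (\<Sum>k<card I. \<Sum>i\<in>I. \<Sum>j\<in>I. l k * (cnj (w i) * (u k i * cnj (u k j)) * w j))"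
      by (rule sum.swap)
    also have "\<dots> = (\<Sum>k<card I. l k * quad_form I (\<lambda>i j. u k i * cnj (u k j)) w)"
      by (simp add: quad_form_def sum_distrib_left)
    also have "\<dots> = (\<Sum>k<card I. l k * complex_of_real ((cmod (\<Sum>i\<in>I. cnj (w i) * u k i))\<^sup>2))"
      unfolding quad_form_rank_one complex_norm_square ..
    finally show ?thesis by (simp del: of_real_power)
  qed
  have l0: "0 \<le> Re (l k)" if "k < card I" for k
  proof -
    have "Re (quad_form I M (u k)) = (\<Sum>j<card I. if j = k then Re (l k) else 0)"
      unfolding quad using that by (intro sum.cong refl) (auto simp: orth)
    then show ?thesis using psd_op_quadD[OF psd, of "u k"] that by simp
  qed
  show ?thesis
  proof (rule that[of "\<lambda>k. Re (l k)" p])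
    fix k assume k: "k < card I"
    have "complex_of_real (\<Sum>i\<in>I. p k i) = 1"
      using orth[OF k k] by (simp add: p mult.commute)
    then show "(\<Sum>i\<in>I. p k i) = 1" by (simp only: of_real_eq_1_iff)
  next
    fix i assume i: "i \<in> I"
    have "complex_of_real (\<Sum>k<card I. p k i) = 1"
      using compl[OF i i] by (simp add: p)
    then show "(\<Sum>k<card I. p k i) = 1" by (simp only: of_real_eq_1_iff)
    show "Re (M i i) = (\<Sum>k<card I. Re (l k) * p k i)"
      unfolding M[OF i i] p[symmetric] by simp
  next
    fix s :: "'a \<Rightarrow> real" and k
    assume s: "\<And>i. i \<in> I \<Longrightarrow> 0 < s i" and le: "psd_op I (\<lambda>i j. diag_op s i j - M i j)" and k: "k < card I"
    \<comment> \<open>The form of diag s at \<open>w\<close> is \<open>q\<close>, while the form of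
      \<open>M\<close> at \<open>w\<close> is at least its \<open>k\<close>-th spectral term l q^2.
      Hence l q^2 \<le> q, and a nonzero \<open>q\<close> cancels.\<close>
    define q where "q = (\<Sum>i\<in>I. p k i / s i)"
    define w where "w = (\<lambda>i. u k i / complex_of_real (s i))"
    have "(\<Sum>i\<in>I. cnj (w i) * u k i) = complex_of_real q"
      unfolding q_def of_real_sum of_real_divide p w_def by (intro sum.cong refl) simp
    then have "Re (l k) * q\<^sup>2 = Re (l k) * (cmod (\<Sum>i\<in>I. cnj (w i) * u k i))\<^sup>2"
      by simp
    also have "\<dots> \<le> Re (quad_form I M w)"
      unfolding quad using l0 k by (intro member_le_sum) auto
    also have "\<dots> \<le> Re (quad_form I (diag_op s) w)"
      using psd_op_quadD[OF le, of w] by (simp add: quad_form_diff)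
    also have "\<dots> = q"
      unfolding quad_form_diag_op[OF fin] q_def Re_complex_of_real
      using s by (intro sum.cong refl) (auto simp: w_def p_def norm_divide power_divide power2_eq_square)
    finally have "Re (l k) * q * q \<le> 1 * q" by (simp add: power2_eq_square)
    moreover have "0 \<le> q" unfolding q_def p_def using s by (intro sum_nonneg divide_nonneg_nonneg) (auto simp: less_imp_le)
    ultimately show "Re (l k) * (\<Sum>i\<in>I. p k i / s i) \<le> 1"
      unfolding q_def[symmetric] by (cases "q = 0") (simp_all add: mult_le_cancel_right)
  qed (use l0 ent in \<open>auto simp: p_def\<close>)
qed

section \<open>Relative entropy estimates\<close>

text \<open>The scalar form of Klein's inequality, from ln z \<le> z - 1 at z = y / x. For x = 0 the
  right side is 0, as in the convention for entropy.\<close>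

lemma diff_le_mult_ln:
  fixes x y :: real
  assumes "0 \<le> x" "0 < y"
  shows "x - y \<le> x * (ln x - ln y)"
proof (cases "x = 0")
  case False
  then have x: "0 < x" using assms by simp
  have "ln (y / x) \<le> y / x - 1" using x assms by (intro ln_le_minus_one) simp
  then have "x * ln (y / x) \<le> x * (y / x - 1)" using x by (intro mult_left_mono) auto
  then show ?thesis using x assms by (simp add: ln_div algebra_simps)
qed (use assms in simp)

text \<open>Nonnegativity of the relative entropy of \<open>M\<close> to the state diag s / T. As
  that state is diagonal, it meets \<open>M\<close> only through the diagonal entries.\<close>

lemma vn_entropy_le_cross_entropy:
  assumes fin: "finite I" and psd: "psd_op I M" and tr: "trace_op I M = 1"
    and s: "\<And>i. i \<in> I \<Longrightarrow> 0 < s i"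
  shows "vn_entropy I M \<le> log 2 (\<Sum>i\<in>I. s i) - (\<Sum>i\<in>I. Re (M i i) * log 2 (s i))"
proof -
  obtain l p where l: "\<And>k. k < card I \<Longrightarrow> 0 \<le> l k" and p: "\<And>k i. 0 \<le> p k i"
    and p1: "\<And>k. k < card I \<Longrightarrow> (\<Sum>i\<in>I. p k i) = 1" and p2: "\<And>i. i \<in> I \<Longrightarrow> (\<Sum>k<card I. p k i) = 1"
    and M: "\<And>i. i \<in> I \<Longrightarrow> Re (M i i) = (\<Sum>k<card I. l k * p k i)"
    and ent: "vn_entropy I M = - (\<Sum>k<card I. l k * log 2 (l k))"
    by (rule psd_op_spectral[OF fin psd]) blast
  define T where "T = (\<Sum>i\<in>I. s i)"
  have "I \<noteq> {}" using tr by (auto simp: trace_op_def)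
  then have T: "0 < T" unfolding T_def using fin s by (intro sum_pos) auto
  have trM: "(\<Sum>i\<in>I. Re (M i i)) = 1" using tr by (metis Re_sum one_complex.sel(1) trace_op_def)
  have sl: "(\<Sum>k<card I. l k) = 1"
  proof -
    have "1 = (\<Sum>i\<in>I. \<Sum>k<card I. l k * p k i)" using trM M by simp
    also have "\<dots> = (\<Sum>k<card I. l k * (\<Sum>i\<in>I. p k i))" by (subst sum.swap) (simp add: sum_distrib_left)
    finally show ?thesis using p1 by simp
  qed
  \<comment> \<open>Both double sums are one, since the eigenvalues \<open>l k\<close> and the
    weights s / T each have total one.\<close>
  have "0 = (\<Sum>k<card I. \<Sum>i\<in>I. p k i * l k) - (\<Sum>i\<in>I. \<Sum>k<card I. p k i * (s i / T))"
    using T by (simp add: sum_distrib_right[symmetric] p1 p2 sl sum_divide_distrib[symmetric] T_def)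
  also have "\<dots> = (\<Sum>k<card I. \<Sum>i\<in>I. p k i * (l k - s i / T))"
    by (subst (2) sum.swap) (simp add: right_diff_distrib sum_subtractf)
  also have "\<dots> \<le> (\<Sum>k<card I. \<Sum>i\<in>I. p k i * (l k * (ln (l k) - ln (s i / T))))"
    using l p s T by (intro sum_mono mult_left_mono diff_le_mult_ln) auto
  also have "\<dots> = (\<Sum>k<card I. \<Sum>i\<in>I. p k i * (l k * ln (l k))) - (\<Sum>k<card I. \<Sum>i\<in>I. l k * p k i * ln (s i / T))"
    by (simp add: algebra_simps sum_subtractf)
  also have "(\<Sum>k<card I. \<Sum>i\<in>I. p k i * (l k * ln (l k))) = (\<Sum>k<card I. l k * ln (l k))"
    by (simp add: sum_distrib_right[symmetric] p1)
  also have "(\<Sum>k<card I. \<Sum>i\<in>I. l k * p k i * ln (s i / T)) = (\<Sum>i\<in>I. Re (M i i) * ln (s i / T))"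
    by (subst sum.swap) (simp add: M sum_distrib_right)
  also have "\<dots> = (\<Sum>i\<in>I. Re (M i i) * ln (s i)) - ln T"
  proof -
    have "Re (M i i) * ln (s i / T) = Re (M i i) * ln (s i) - Re (M i i) * ln T" if "i \<in> I" for i
      using s[OF that] T by (simp add: ln_div right_diff_distrib)
    then show ?thesis
      by (simp add: sum_subtractf sum_distrib_right[symmetric] trM)
  qed
  finally have "- (\<Sum>k<card I. l k * ln (l k)) \<le> ln T - (\<Sum>i\<in>I. Re (M i i) * ln (s i))"
    by simp
  then have "- (\<Sum>k<card I. l k * ln (l k)) / ln 2 \<le> (ln T - (\<Sum>i\<in>I. Re (M i i) * ln (s i))) / ln 2"
    by (intro divide_right_mono) auto
  then show ?thesis
    by (simp add: ent log_def T_def[symmetric] diff_divide_distrib sum_divide_distrib)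
qed

text \<open>
  A unit eigenvector \<open>u\<close> of \<open>M\<close> for \<open>l > 0\<close> satisfies \<open>l \<Sum>\<^sub>i |u\<^sub>i|\<^sup>2 / s\<^sub>i \<le> 1\<close>; concavity of the logarithm then
  gives \<open>ln l \<le> \<Sum>\<^sub>i |u\<^sub>i|\<^sup>2 ln s\<^sub>i\<close>, so that operator monotonicity of the logarithm is not needed.
\<close>

lemma uminus_vn_entropy_le:
  assumes fin: "finite I" and psd: "psd_op I M"
    and s: "\<And>i. i \<in> I \<Longrightarrow> 0 < s i" and le: "psd_op I (\<lambda>i j. diag_op s i j - M i j)"
  shows "- vn_entropy I M \<le> (\<Sum>i\<in>I. Re (M i i) * log 2 (s i))"
proof -
  obtain l p where l: "\<And>k. k < card I \<Longrightarrow> 0 \<le> l k" and p: "\<And>k i. 0 \<le> p k i"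
    and p1: "\<And>k. k < card I \<Longrightarrow> (\<Sum>i\<in>I. p k i) = 1"
    and M: "\<And>i. i \<in> I \<Longrightarrow> Re (M i i) = (\<Sum>k<card I. l k * p k i)"
    and ent: "vn_entropy I M = - (\<Sum>k<card I. l k * log 2 (l k))"
    and bound: "\<And>s k. (\<And>i. i \<in> I \<Longrightarrow> 0 < s i) \<Longrightarrow> psd_op I (\<lambda>i j. diag_op s i j - M i j) \<Longrightarrow> k < card I
       \<Longrightarrow> l k * (\<Sum>i\<in>I. p k i / s i) \<le> 1"
    by (rule psd_op_spectral[OF fin psd]) blast
  have q: "l k * (\<Sum>i\<in>I. p k i / s i) \<le> 1" if "k < card I" for k
    using bound[OF s le that] .
  have "l k * ln (l k) \<le> l k * (\<Sum>i\<in>I. p k i * ln (s i))" if k: "k < card I" for k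
  proof (cases "l k = 0")
    case False
    then have lk: "0 < l k" using l[OF k] by simp
    have "ln (l k) - (\<Sum>i\<in>I. p k i * ln (s i)) = (\<Sum>i\<in>I. p k i * ln (l k / s i))"
    proof -
      have "p k i * ln (l k / s i) = p k i * ln (l k) - p k i * ln (s i)" if "i \<in> I" for i
        using s[OF that] lk by (simp add: ln_div right_diff_distrib)
      then show ?thesis
        by (simp add: sum_subtractf sum_distrib_right[symmetric] p1[OF k])
    qed
    also have "\<dots> \<le> (\<Sum>i\<in>I. p k i * (l k / s i - 1))"
      using p s lk by (intro sum_mono mult_left_mono ln_le_minus_one) auto
    also have "\<dots> = l k * (\<Sum>i\<in>I. p k i / s i) - 1"
      using p1[OF k] by (simp add: right_diff_distrib sum_subtractf sum_distrib_left mult.commute)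
    also have "\<dots> \<le> 0" using q[OF k] by simp
    finally show ?thesis using lk by simp
  qed simp
  then have "(\<Sum>k<card I. l k * ln (l k)) \<le> (\<Sum>k<card I. l k * (\<Sum>i\<in>I. p k i * ln (s i)))"
    by (intro sum_mono) auto
  also have "\<dots> = (\<Sum>i\<in>I. Re (M i i) * ln (s i))"
    unfolding sum_distrib_left by (subst sum.swap) (simp add: M sum_distrib_right mult.assoc)
  finally have "(\<Sum>k<card I. l k * ln (l k)) / ln 2 \<le> (\<Sum>i\<in>I. Re (M i i) * ln (s i)) / ln 2"
    by (intro divide_right_mono) auto
  then show ?thesis
    by (simp add: ent log_def sum_divide_distrib)
qed

text \<open>The average output is estimated by its cross entropy and each single output by the
  operator bound diag s. The terms in log s are linear in the state, so they cancel and only the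
  logarithm of the total weight remains.\<close>

lemma (in zeta_feasible) holevo_le:
  assumes N: "\<And>\<rho> b b'. b \<in> B \<Longrightarrow> b' \<in> B \<Longrightarrow> N \<rho> b b' = of_choi A J \<rho> b b'"
    and tp: "\<And>a a'. a \<in> A \<Longrightarrow> a' \<in> A \<Longrightarrow> (\<Sum>b\<in>B. J (a, b) (a', b)) = (if a = a' then 1 else 0)"
    and S: "\<And>b b'. b \<in> B \<Longrightarrow> b' \<in> B \<Longrightarrow> S b b' = diag_op s b b'"
    and s: "\<And>b. b \<in> B \<Longrightarrow> 0 < s b" and "A \<noteq> {}"
  shows "holevo A B N \<le> log 2 (\<Sum>b\<in>B. s b)"
  unfolding holevo_def
proof (rule cSup_least)
  obtain a where a: "a \<in> A" using \<open>A \<noteq> {}\<close> by blast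
  \<comment> \<open>The ensemble of a single basis state shows that the supremum is over a nonempty
    set.\<close>
  have "psd_op A (\<lambda>i j. (if i = a then 1 else 0) * cnj (if j = a then 1 else 0))"
    by (rule psd_op_rank_one)
  then have "psd_op A (ketbra a a)" by (rule psd_op_cong) (auto simp: ketbra_def)
  moreover have "trace_op A (ketbra a a) = 1"
    using fin a by (simp add: trace_op_def ketbra_def)
  ultimately have "ensemble A 1 (\<lambda>_. 1) (\<lambda>_. ketbra a a)" by (simp add: ensemble_def density_op_def)
  then show "{vn_entropy B (\<lambda>x y. \<Sum>i<k. complex_of_real (p i) * N (\<rho> i) x y)
                       - (\<Sum>i<k. p i * vn_entropy B (N (\<rho> i))) | k p \<rho>. ensemble A k p \<rho>} \<noteq> {}"
    by blast
next
  fix x assume "x \<in> {vn_entropy B (\<lambda>x y. \<Sum>i<k. complex_of_real (p i) * N (\<rho> i) x y)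
                       - (\<Sum>i<k. p i * vn_entropy B (N (\<rho> i))) | k p \<rho>. ensemble A k p \<rho>}"
  then obtain k p \<rho> where x: "x = vn_entropy B (\<lambda>x y. \<Sum>i<k. complex_of_real (p i) * N (\<rho> i) x y)
                       - (\<Sum>i<k. p i * vn_entropy B (N (\<rho> i)))" and ens: "ensemble A k p \<rho>" by blast
  have p0: "0 \<le> p i" and dens: "density_op A (\<rho> i)" if "i < k" for i
    using ens that by (auto simp: ensemble_def)
  have p1: "(\<Sum>i<k. p i) = 1" using ens by (simp add: ensemble_def)
  define \<omega> where "\<omega> = (\<lambda>x y. \<Sum>i<k. complex_of_real (p i) * N (\<rho> i) x y)"
  have psd: "psd_op B (N (\<rho> i))" if "i < k" for i
  proof (rule psd_op_cong)
    show "psd_op B (of_choi A J (\<rho> i))"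
      using dens[OF that] by (intro psd_op_of_choi fin J) (simp add: density_op_def)
  qed (simp add: N)
  have tr: "trace_op B (N (\<rho> i)) = 1" if "i < k" for i
  proof -
    have "trace_op B (N (\<rho> i)) = (\<Sum>b\<in>B. \<Sum>a\<in>A. \<Sum>a'\<in>A. \<rho> i a a' * J (a, b) (a', b))"
      by (simp add: trace_op_def N of_choi_def)
    also have "\<dots> = (\<Sum>a\<in>A. \<Sum>a'\<in>A. \<rho> i a a' * (\<Sum>b\<in>B. J (a, b) (a', b)))"
      unfolding sum_distrib_left by (subst sum.swap, intro sum.cong refl, rule sum.swap)
    also have "\<dots> = (\<Sum>a\<in>A. \<Sum>a'\<in>A. if a' = a then \<rho> i a a else 0)"
      by (intro sum.cong refl) (auto simp: tp)
    also have "\<dots> = 1" using fin dens[OF that] by (simp add: density_op_def trace_op_def)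
    finally show ?thesis .
  qed
  have le: "psd_op B (\<lambda>b b'. diag_op s b b' - N (\<rho> i) b b')" if "i < k" for i
    by (rule psd_op_cong[OF of_choi_le[OF dens[OF that]]]) (auto simp: S N diag_op_def)
  have \<omega>_psd: "psd_op B \<omega>"
    unfolding \<omega>_def using psd p0 by (intro psd_op_sum psd_op_scale) auto
  have \<omega>_tr: "trace_op B \<omega> = 1"
  proof -
    have "trace_op B \<omega> = (\<Sum>i<k. complex_of_real (p i) * trace_op B (N (\<rho> i)))"
      unfolding trace_op_def \<omega>_def sum_distrib_left by (rule sum.swap)
    also have "\<dots> = complex_of_real (\<Sum>i<k. p i)" by (simp add: tr)
    finally show ?thesis using p1 by simp
  qed
  have "vn_entropy B \<omega> \<le> log 2 (\<Sum>b\<in>B. s b) - (\<Sum>b\<in>B. Re (\<omega> b b) * log 2 (s b))"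
    by (rule vn_entropy_le_cross_entropy[OF fin(2) \<omega>_psd \<omega>_tr s])
  also have "(\<Sum>b\<in>B. Re (\<omega> b b) * log 2 (s b)) = (\<Sum>i<k. p i * (\<Sum>b\<in>B. Re (N (\<rho> i) b b) * log 2 (s b)))"
    unfolding \<omega>_def sum_distrib_left by (subst sum.swap) (simp add: sum_distrib_right mult.assoc)
  finally have 1: "vn_entropy B \<omega> \<le> log 2 (\<Sum>b\<in>B. s b) - (\<Sum>i<k. p i * (\<Sum>b\<in>B. Re (N (\<rho> i) b b) * log 2 (s b)))" .
  have "(\<Sum>i<k. p i * (- vn_entropy B (N (\<rho> i)))) \<le> (\<Sum>i<k. p i * (\<Sum>b\<in>B. Re (N (\<rho> i) b b) * log 2 (s b)))"
    using p0 psd le s fin by (intro sum_mono mult_left_mono uminus_vn_entropy_le) auto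
  then show "x \<le> log 2 (\<Sum>b\<in>B. s b)"
    using 1 unfolding x \<omega>_def[symmetric] by (simp add: sum_negf)
qed

section \<open>Capacity bounds from a feasible pair\<close>

lemma bipartite_power_trace_preserving:
  assumes "finite B" "\<And>a a'. a \<in> A \<Longrightarrow> a' \<in> A \<Longrightarrow> (\<Sum>b\<in>B. J (a, b) (a', b)) = (if a = a' then 1 else 0)"
    and xs: "xs \<in> sys_power A n" "ys \<in> sys_power A n"
  shows "(\<Sum>b\<in>sys_power B n. bipartite_power n J (xs, b) (ys, b)) = (if xs = ys then 1 else 0)"
proof -
  have "(\<Sum>b\<in>sys_power B n. bipartite_power n J (xs, b) (ys, b)) = (\<Prod>k<n. \<Sum>b\<in>B. J (xs ! k, b) (ys ! k, b))"
    unfolding bipartite_power_def prod.case by (rule sum_sys_power_prod)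
  also have "\<dots> = (\<Prod>k<n. if xs ! k = ys ! k then 1 else 0)"
    using xs by (intro prod.cong refl assms(2)) (auto simp: sys_power_nth)
  finally show ?thesis using prod_delta_sys_power[OF xs, of "\<lambda>_. 1"] by simp
qed

lemma tensor_power_diag_op:
  assumes "xs \<in> sys_power B n" "ys \<in> sys_power B n"
  shows "tensor_power n (diag_op s) xs ys = diag_op (\<lambda>xs. \<Prod>k<n. s (xs ! k)) xs ys"
  using prod_delta_sys_power[OF assms, of "\<lambda>k. complex_of_real (s (xs ! k))"]
  by (simp add: tensor_power_def diag_op_def)

locale channel_feasible = zeta_feasible A B "choi A N" V S
  for A :: "'a set" and B :: "'b set" and N V S +
  assumes nonempty: "A \<noteq> {}" "B \<noteq> {}"
    and tp: "\<And>a a'. a \<in> A \<Longrightarrow> a' \<in> A \<Longrightarrow> (\<Sum>b\<in>B. choi A N (a, b) (a', b)) = (if a = a' then 1 else 0)"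
begin

text \<open>The power of \<open>S\<close> is diagonal with the products of \<open>s\<close> as
  weights. Their total is the \<open>n\<close>-th power of the sum of \<open>s\<close>, so the
  Holevo bound for \<open>n\<close> uses is \<open>n\<close> times the bound for one.\<close>

lemma classical_capacity_le:
  assumes S: "S = diag_op s" and s: "\<And>b. b \<in> B \<Longrightarrow> 0 < s b"
  shows "classical_capacity A B N \<le> log 2 (\<Sum>b\<in>B. s b)"
  unfolding classical_capacity_def
proof (rule cSUP_least)
  fix n :: nat assume n: "n \<in> {1..}"
  interpret pow: zeta_feasible "sys_power A n" "sys_power B n" "bipartite_power n (choi A N)" "bipartite_power n V" "tensor_power n S"
    by (rule bipartite_power_feasible)
  have pos: "0 < (\<Sum>b\<in>B. s b)" using s fin nonempty by (intro sum_pos) auto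
  have "holevo (sys_power A n) (sys_power B n) (chan_power A N n) \<le> log 2 (\<Sum>xs\<in>sys_power B n. \<Prod>k<n. s (xs ! k))"
    using S s
    by (intro pow.holevo_le bipartite_power_trace_preserving tp fin sys_power_nonempty nonempty)
      (auto simp: chan_power_eq fin tensor_power_diag_op sys_power_nth intro!: prod_pos)
  also have "(\<Sum>xs\<in>sys_power B n. \<Prod>k<n. s (xs ! k)) = (\<Sum>b\<in>B. s b) ^ n"
    using sum_sys_power_prod[of "\<lambda>_. s" n B] by simp
  also have "log 2 ((\<Sum>b\<in>B. s b) ^ n) = real n * log 2 (\<Sum>b\<in>B. s b)"
    using pos by (simp add: log_nat_power)
  finally show "holevo (sys_power A n) (sys_power B n) (chan_power A N n) / real n \<le> log 2 (\<Sum>b\<in>B. s b)"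
    using n by (simp add: divide_le_eq mult.commute)
qed auto

lemma success_prob_power_le:
  assumes "nsppt_code (sys_power A n) (sys_power B n) m Z" and S: "trace_op B S = complex_of_real c"
  shows "success_prob (sys_power A n) (sys_power B n) (chan_power A N n) m Z \<le> c ^ n / real m"
proof -
  have "finite A" by (rule fin)
  interpret pow: zeta_feasible "sys_power A n" "sys_power B n" "bipartite_power n (choi A N)" "bipartite_power n V" "tensor_power n S"
    by (rule bipartite_power_feasible)
  interpret nsppt "sys_power A n" "sys_power B n" m Z
    using assms fin by unfold_locales (auto simp: finite_sys_power)
  note choi = choi_chan_power[OF \<open>finite A\<close>, of _ n B]
  have "success_prob (sys_power A n) (sys_power B n) (chan_power A N n) m Z \<le>
      Re (trace_op (sys_power B n) (tensor_power n S)) / real m"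
    by (rule success_prob_le[OF psd_op_cong[OF pow.VJ] pow.SV]) (simp add: choi)
  also have "Re (trace_op (sys_power B n) (tensor_power n S)) = c ^ n"
    unfolding trace_tensor_power S of_real_power[symmetric] by simp
  finally show ?thesis .
qed

lemma f_nsppt_power_le:
  assumes "m > 0" and S: "trace_op B S = complex_of_real c"
  shows "f_nsppt (sys_power A n) (sys_power B n) (chan_power A N n) m \<le> c ^ n / real m"
  unfolding f_nsppt_def
proof (rule cSUP_least)
  show "{Z. nsppt_code (sys_power A n) (sys_power B n) m Z} \<noteq> {}"
    using nsppt_code_exists[of "sys_power A n" "sys_power B n" m] fin nonempty assms(1)
    by (auto simp: finite_sys_power sys_power_nonempty)
qed (use success_prob_power_le[OF _ S] in auto)

lemma f_nsppt_power_one: "f_nsppt (sys_power A n) (sys_power B n) (chan_power A N n) 1 = 1"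
proof -
  let ?C = "{Z. nsppt_code (sys_power A n) (sys_power B n) 1 Z}"
  have "?C \<noteq> {}"
    using nsppt_code_exists[of "sys_power A n" "sys_power B n" 1] fin nonempty
    by (auto simp: finite_sys_power sys_power_nonempty)
  moreover have "success_prob (sys_power A n) (sys_power B n) (chan_power A N n) 1 Z = 1" if "Z \<in> ?C" for Z
  proof (rule success_prob_one_message)
    show "nsppt (sys_power A n) (sys_power B n) 1 Z"
      using that fin by unfold_locales (auto simp: finite_sys_power)
    show "sys_power B n \<noteq> {}" using nonempty by (intro sys_power_nonempty)
    fix a a' assume a: "a \<in> sys_power A n" "a' \<in> sys_power A n"
    have "(\<Sum>b\<in>sys_power B n. choi (sys_power A n) (chan_power A N n) (a, b) (a', b)) =
        (\<Sum>b\<in>sys_power B n. bipartite_power n (choi A N) (a, b) (a', b))"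
      using a fin by (intro sum.cong refl choi_chan_power) auto
    then show "(\<Sum>b\<in>sys_power B n. choi (sys_power A n) (chan_power A N n) (a, b) (a', b)) = (if a = a' then 1 else 0)"
      using bipartite_power_trace_preserving[OF fin(2) tp a] by simp
  qed
  ultimately have "(success_prob (sys_power A n) (sys_power B n) (chan_power A N n) 1) ` ?C = {1}"
    by (auto simp: image_iff)
  then show ?thesis unfolding f_nsppt_def by simp
qed

text \<open>At a rate above log c the optimal success probability is at most 2 q^n with q < 1, so it
  cannot tend to 1.\<close>

lemma C_nsppt_le:
  assumes S: "trace_op B S = complex_of_real c" and c: "1 \<le> c"
  shows "C_nsppt A B N \<le> log 2 c"
  unfolding C_nsppt_def
proof (rule cSup_least)
  \<comment> \<open>Rate 0 means exactly one message for every \<open>n\<close>.\<close>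
  have "0 \<in> {r. (\<lambda>n. f_nsppt (sys_power A n) (sys_power B n) (chan_power A N n)
            (nat \<lfloor>2 powr (r * real n)\<rfloor>)) \<longlonglongrightarrow> 1}"
    using f_nsppt_power_one by simp
  then show "{r. (\<lambda>n. f_nsppt (sys_power A n) (sys_power B n) (chan_power A N n)
            (nat \<lfloor>2 powr (r * real n)\<rfloor>)) \<longlonglongrightarrow> 1} \<noteq> {}"
    by blast
next
  fix r assume "r \<in> {r. (\<lambda>n. f_nsppt (sys_power A n) (sys_power B n) (chan_power A N n)
            (nat \<lfloor>2 powr (r * real n)\<rfloor>)) \<longlonglongrightarrow> 1}"
  then have lim: "(\<lambda>n. f_nsppt (sys_power A n) (sys_power B n) (chan_power A N n)
            (nat \<lfloor>2 powr (r * real n)\<rfloor>)) \<longlonglongrightarrow> 1" by simp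
  show "r \<le> log 2 c"
  proof (rule ccontr)
    assume "\<not> r \<le> log 2 c"
    then have r: "log 2 c < r" by simp
    moreover have "0 \<le> log 2 c" using c by simp
    ultimately have r0: "0 < r" by linarith
    define q where "q = c / 2 powr r"
    have q: "0 \<le> q" "q < 1"
      using r c by (auto simp: q_def log_less_iff)
    have "f_nsppt (sys_power A n) (sys_power B n) (chan_power A N n) (nat \<lfloor>2 powr (r * real n)\<rfloor>) \<le> 2 * q ^ n" for n
    proof -
      define x where "x = 2 powr (r * real n)"
      have x1: "1 \<le> x" unfolding x_def using r0 by (intro ge_one_powr_ge_zero) auto
      have xn: "x = (2 powr r) ^ n" unfolding x_def by (simp add: powr_powr[symmetric] powr_realpow)
      have f1: "1 \<le> \<lfloor>x\<rfloor>" using x1 by simp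
      then have m: "0 < nat \<lfloor>x\<rfloor>" by simp
      \<comment> \<open>Rounding down at most halves a number that is at least 1; this is the factor
        2 in the bound.\<close>
      have "x / 2 \<le> real_of_int \<lfloor>x\<rfloor>"
        using f1 real_of_int_floor_add_one_gt[of x] by linarith
      then have mx: "x / 2 \<le> real (nat \<lfloor>x\<rfloor>)" using f1 by simp
      have "f_nsppt (sys_power A n) (sys_power B n) (chan_power A N n) (nat \<lfloor>x\<rfloor>) \<le> c ^ n / real (nat \<lfloor>x\<rfloor>)"
        by (rule f_nsppt_power_le[OF m S])
      also have "\<dots> \<le> c ^ n / (x / 2)"
        using mx x1 c by (intro divide_left_mono) auto
      also have "\<dots> = 2 * q ^ n" unfolding q_def xn by (simp add: power_divide)
      finally show ?thesis unfolding x_def .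
    qed
    moreover have lim': "(\<lambda>n. 2 * q ^ n) \<longlonglongrightarrow> 2 * 0"
      using q by (intro tendsto_mult_left LIMSEQ_power_zero) auto
    ultimately have "1 \<le> 2 * (0 :: real)"
      using LIMSEQ_le[OF lim lim'] by blast
    then show False by simp
  qed
qed

end

section \<open>The amplitude damping channel\<close>

text \<open>
  The entry \<open>e\<close> couples the labels \<open>00\<close> and \<open>11\<close>, and \<open>g\<close> couples \<open>01\<close> and \<open>10\<close>, so that the partial
  transpose exchanges \<open>e\<close> and \<open>g\<close>.
\<close>

definition x_op :: "real \<Rightarrow> real \<Rightarrow> real \<Rightarrow> real \<Rightarrow> real \<Rightarrow> real \<Rightarrow> (nat \<times> nat) lop" where
  "x_op d0 d1 d2 d3 e g = (\<lambda>(a, b) (a', b'). complex_of_real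
     (if a = a' \<and> b = b' then (if a = 0 then (if b = 0 then d0 else d1) else (if b = 0 then d2 else d3))
      else if a = a' \<or> b = b' then 0 else if a = b \<and> a' = b' then e
      else if a \<noteq> b \<and> a' \<noteq> b' then g else 0))"

lemma sum_qubit: "(\<Sum>a\<in>qubit. f a) = f 0 + f 1"
  by (simp add: qubit_def)

lemma in_qubit: "a \<in> qubit \<longleftrightarrow> a = 0 \<or> a = 1"
  by (simp add: qubit_def)

lemma finite_qubit: "finite qubit"
  by (simp add: qubit_def)

text \<open>With real entries the form separates into the blocks 00/11 and 01/10, and in each block
  into real and imaginary parts: four real binary forms.\<close>

lemma quad_form_x_op:
  "Re (quad_form (qubit \<times> qubit) (x_op d0 d1 d2 d3 e g) v) =
    (d0 * (Re (v (0,0)))\<^sup>2 + d3 * (Re (v (1,1)))\<^sup>2 + 2 * e * Re (v (0,0)) * Re (v (1,1))) +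
    (d0 * (Im (v (0,0)))\<^sup>2 + d3 * (Im (v (1,1)))\<^sup>2 + 2 * e * Im (v (0,0)) * Im (v (1,1))) +
    (d1 * (Re (v (0,1)))\<^sup>2 + d2 * (Re (v (1,0)))\<^sup>2 + 2 * g * Re (v (0,1)) * Re (v (1,0))) +
    (d1 * (Im (v (0,1)))\<^sup>2 + d2 * (Im (v (1,0)))\<^sup>2 + 2 * g * Im (v (0,1)) * Im (v (1,0)))"
  unfolding quad_form_def sum.cartesian_product' sum_qubit
  by (simp add: x_op_def power2_eq_square algebra_simps)

text \<open>Completing the square after multiplication by \<open>a\<close>; for a = 0 the
  determinant condition forces e = 0.\<close>

lemma binary_form_ge_0:
  fixes a b e p q :: real
  assumes "0 \<le> a" "0 \<le> b" "e\<^sup>2 \<le> a * b"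
  shows "0 \<le> a * p\<^sup>2 + b * q\<^sup>2 + 2 * e * p * q"
proof (cases "a = 0")
  case False
  have "a * (a * p\<^sup>2 + b * q\<^sup>2 + 2 * e * p * q) = (a * p + e * q)\<^sup>2 + (a * b - e\<^sup>2) * q\<^sup>2"
    by (simp add: power2_eq_square algebra_simps)
  also have "0 \<le> \<dots>" using assms by simp
  finally show ?thesis using False assms(1) by (simp add: zero_le_mult_iff)
qed (use assms in simp)

lemma psd_op_x_op:
  assumes "0 \<le> d0" "0 \<le> d1" "0 \<le> d2" "0 \<le> d3" "e\<^sup>2 \<le> d0 * d3" "g\<^sup>2 \<le> d1 * d2"
  shows "psd_op (qubit \<times> qubit) (x_op d0 d1 d2 d3 e g)"
  unfolding psd_op_iff
proof (intro conjI allI ballI)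
  fix v :: "nat \<times> nat \<Rightarrow> complex"
  note e = binary_form_ge_0[OF assms(1,4,5)] and g = binary_form_ge_0[OF assms(2,3,6)]
  show "0 \<le> Re (quad_form (qubit \<times> qubit) (x_op d0 d1 d2 d3 e g) v)"
    unfolding quad_form_x_op
    using e[of "Re (v (0,0))" "Re (v (1,1))"] e[of "Im (v (0,0))" "Im (v (1,1))"]
      g[of "Re (v (0,1))" "Re (v (1,0))"] g[of "Im (v (0,1))" "Im (v (1,0))"] by linarith
qed (auto simp: x_op_def)

lemma x_op_diff: "x_op d0 d1 d2 d3 e g x y - x_op d0' d1' d2' d3' e' g' x y =
    x_op (d0 - d0') (d1 - d1') (d2 - d2') (d3 - d3') (e - e') (g - g') x y"
  and x_op_add: "x_op d0 d1 d2 d3 e g x y + x_op d0' d1' d2' d3' e' g' x y =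
    x_op (d0 + d0') (d1 + d1') (d2 + d2') (d3 + d3') (e + e') (g + g') x y"
  by (auto simp: x_op_def split: prod.splits)

lemma ptranspose_x_op:
  "x \<in> qubit \<times> qubit \<Longrightarrow> y \<in> qubit \<times> qubit \<Longrightarrow>
    ptranspose (x_op d0 d1 d2 d3 e g) x y = x_op d0 d1 d2 d3 g e x y"
  by (auto simp: ptranspose_def x_op_def in_qubit)

lemma tensor_id_diag_op:
  "x \<in> qubit \<times> qubit \<Longrightarrow> y \<in> qubit \<times> qubit \<Longrightarrow>
    tensor_id (diag_op s) x y = x_op (s 0) (s 1) (s 0) (s 1) 0 0 x y"
  by (auto simp: tensor_id_def diag_op_def x_op_def in_qubit)

lemma psd_op_x_opI:
  assumes "\<And>x y. x \<in> qubit \<times> qubit \<Longrightarrow> y \<in> qubit \<times> qubit \<Longrightarrow> M x y = x_op d0 d1 d2 d3 e g x y"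
    "0 \<le> d0" "0 \<le> d1" "0 \<le> d2" "0 \<le> d3" "e\<^sup>2 \<le> d0 * d3" "g\<^sup>2 \<le> d1 * d2"
  shows "psd_op (qubit \<times> qubit) M"
  using psd_op_cong[OF psd_op_x_op[OF assms(2-7)]] assms(1) by simp

lemma hermitian_x_op: "hermitian_op I (x_op d0 d1 d2 d3 e g)"
  by (auto simp: hermitian_op_def eq_op_def adj_op_def x_op_def)

lemma hermitian_diag_op: "hermitian_op I (diag_op s)"
  by (auto simp: hermitian_op_def eq_op_def adj_op_def diag_op_def)


lemma choi_amp_damp:
  assumes "0 \<le> \<gamma>" "\<gamma> \<le> 1" "x \<in> qubit \<times> qubit" "y \<in> qubit \<times> qubit"
  shows "choi qubit (amp_damp \<gamma>) x y = x_op 1 0 \<gamma> (1 - \<gamma>) (sqrt (1 - \<gamma>)) 0 x y"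
proof -
  have sq: "complex_of_real (sqrt (1 - \<gamma>)) * complex_of_real (sqrt (1 - \<gamma>)) = complex_of_real (1 - \<gamma>)"
    "complex_of_real (sqrt \<gamma>) * complex_of_real (sqrt \<gamma>) = complex_of_real \<gamma>"
    using assms by (simp_all flip: of_real_mult)
  obtain a b a' b' where xy: "x = (a, b)" "y = (a', b')" by fastforce
  then have "choi qubit (amp_damp \<gamma>) x y = amp_damp \<gamma> (ketbra a a') b b'"
    using assms by (simp add: choi_entry finite_qubit)
  also have "\<dots> = x_op 1 0 \<gamma> (1 - \<gamma>) (sqrt (1 - \<gamma>)) 0 x y"
    using assms(3,4) sq unfolding xy
    by (auto simp: amp_damp_def mult_op_def sum_qubit adj_op_def AD_E0_def AD_E1_def ketbra_def x_op_def in_qubit)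
  finally show ?thesis .
qed

text \<open>
  For \<open>\<epsilon> = 0\<close> the operators \<open>V - J\<close> and \<open>1 \<otimes> S - V\<^sup>T\<close> have rank at most one, along \<open>|00\<rangle> - |11\<rangle>\<close> and
  \<open>|01\<rangle> - |10\<rangle>\<close>; this is complementary slackness with the dual optimum used in the lower bounds below.
\<close>

lemma amp_damp_feasible:
  assumes \<gamma>: "0 \<le> \<gamma>" "\<gamma> \<le> 1" and \<epsilon>: "0 \<le> \<epsilon>"
  defines "s \<equiv> sqrt (1 - \<gamma>)"
  shows "channel_feasible qubit qubit (amp_damp \<gamma>)
    (x_op (1 + (s - s\<^sup>2) / 2) 0 \<gamma> ((s + s\<^sup>2) / 2) ((s + s\<^sup>2) / 2) 0)
    (diag_op (\<lambda>b. (if b = 0 then 1 + (s - s\<^sup>2) / 2 else (s + s\<^sup>2) / 2) + \<epsilon>))"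
proof unfold_locales
  have s: "0 \<le> s" "s \<le> 1" and s2: "1 - \<gamma> = s\<^sup>2" "\<gamma> = 1 - s\<^sup>2"
    using \<gamma> by (auto simp: s_def)
  have s2s: "s\<^sup>2 \<le> s" using s by (simp add: power2_eq_square mult_left_le)
  have s20: "0 \<le> s\<^sup>2" "0 \<le> (s + s\<^sup>2) / 2 + \<epsilon>" "0 \<le> s + s\<^sup>2 + \<epsilon>"
    using s \<epsilon> by simp_all
  define c where "c = (s + s\<^sup>2) / 2"
  have c0: "0 \<le> c" using s by (simp add: c_def)
  note J = choi_amp_damp[OF \<gamma>, folded s_def, unfolded s2(1)]
  show "psd_op (qubit \<times> qubit) (choi qubit (amp_damp \<gamma>))"
    by (rule psd_op_x_opI[OF J]) (use \<gamma> s in auto)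
  \<comment> \<open>On the block 00/11 both diagonal entries are (s - s^2) / 2 and the coupling is
    the negative of this, so the determinant is zero; the sign is that of s - s^2.\<close>
  show "psd_op (qubit \<times> qubit) (\<lambda>x y. x_op (1 + (s - s\<^sup>2) / 2) 0 \<gamma> ((s + s\<^sup>2) / 2) ((s + s\<^sup>2) / 2) 0 x y - choi qubit (amp_damp \<gamma>) x y)"
    by (rule psd_op_x_opI) (use s2s in \<open>auto simp: J x_op_diff power2_eq_square field_simps\<close>)
  show "psd_op (qubit \<times> qubit) (\<lambda>x y. tensor_id (diag_op (\<lambda>b. (if b = 0 then 1 + (s - s\<^sup>2) / 2 else (s + s\<^sup>2) / 2) + \<epsilon>)) x y
      - ptranspose (x_op (1 + (s - s\<^sup>2) / 2) 0 \<gamma> ((s + s\<^sup>2) / 2) ((s + s\<^sup>2) / 2) 0) x y)"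
  proof (rule psd_op_x_opI[of _ "1 + (s - s\<^sup>2) / 2 + \<epsilon> - (1 + (s - s\<^sup>2) / 2)" _ _
      "(s + s\<^sup>2) / 2 + \<epsilon> - (s + s\<^sup>2) / 2" "0 - 0" "0 - (s + s\<^sup>2) / 2"])
    show "(0 - (s + s\<^sup>2) / 2)\<^sup>2 \<le> ((s + s\<^sup>2) / 2 + \<epsilon> - 0) * (1 + (s - s\<^sup>2) / 2 + \<epsilon> - \<gamma>)"
    proof -
      \<comment> \<open>As \<gamma> = 1 - s^2, both diagonal entries on the block 01/10 are c +
        \<epsilon>, against a coupling of -c, with equality in the determinant condition at
        \<epsilon> = 0.\<close>
      have e: "1 + (s - s\<^sup>2) / 2 + \<epsilon> - \<gamma> = c + \<epsilon>" by (simp add: s2 c_def field_simps)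
      have "c * c \<le> (c + \<epsilon>) * (c + \<epsilon>)" using c0 \<epsilon> by (intro mult_mono) auto
      then show ?thesis unfolding e c_def[symmetric] by (simp add: power2_eq_square)
    qed
  qed (use s s2s \<epsilon> s20 s2(2) in \<open>auto simp: tensor_id_diag_op ptranspose_x_op x_op_diff\<close>)
  show "psd_op (qubit \<times> qubit) (\<lambda>x y. tensor_id (diag_op (\<lambda>b. (if b = 0 then 1 + (s - s\<^sup>2) / 2 else (s + s\<^sup>2) / 2) + \<epsilon>)) x y
      + ptranspose (x_op (1 + (s - s\<^sup>2) / 2) 0 \<gamma> ((s + s\<^sup>2) / 2) ((s + s\<^sup>2) / 2) 0) x y)"
  proof (rule psd_op_x_opI[of _ "1 + (s - s\<^sup>2) / 2 + \<epsilon> + (1 + (s - s\<^sup>2) / 2)" _ _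
      "(s + s\<^sup>2) / 2 + \<epsilon> + (s + s\<^sup>2) / 2" "0 + 0" "0 + (s + s\<^sup>2) / 2"])
    show "(0 + (s + s\<^sup>2) / 2)\<^sup>2 \<le> ((s + s\<^sup>2) / 2 + \<epsilon> + 0) * (1 + (s - s\<^sup>2) / 2 + \<epsilon> + \<gamma>)"
    proof -
      have e: "1 + (s - s\<^sup>2) / 2 + \<epsilon> + \<gamma> = c + \<epsilon> + 2 * \<gamma>" by (simp add: s2 c_def field_simps)
      have "c * c \<le> (c + \<epsilon>) * (c + \<epsilon> + 2 * \<gamma>)" using c0 \<epsilon> \<gamma>(1) by (intro mult_mono) auto
      then show ?thesis unfolding e c_def[symmetric] by (simp add: power2_eq_square)
    qed
  qed (use s s2s \<epsilon> s20 \<gamma> in \<open>auto simp: tensor_id_diag_op ptranspose_x_op x_op_add intro!: mult_nonneg_nonneg\<close>)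
  fix a a' assume "a \<in> qubit" "a' \<in> qubit"
  then show "(\<Sum>b\<in>qubit. choi qubit (amp_damp \<gamma>) (a, b) (a', b)) = (if a = a' then 1 else 0)"
    by (auto simp: sum_qubit choi_amp_damp[OF \<gamma>] in_qubit x_op_def)
qed (auto simp: qubit_def)

section \<open>Dual certificates and optimal values\<close>

text \<open>The form at the four basis vectors and at |00> + |11> and |01> + |10>; the dual optima
  are combinations of the projections on these vectors.\<close>

lemma psd_op_qubit_sums:
  assumes "psd_op (qubit \<times> qubit) M"
  shows "0 \<le> Re (M (0,0) (0,0))" "0 \<le> Re (M (0,1) (0,1))" "0 \<le> Re (M (1,0) (1,0))" "0 \<le> Re (M (1,1) (1,1))"
    "0 \<le> Re (M (0,0) (0,0)) + Re (M (0,0) (1,1)) + Re (M (1,1) (0,0)) + Re (M (1,1) (1,1))"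
    "0 \<le> Re (M (0,1) (0,1)) + Re (M (0,1) (1,0)) + Re (M (1,0) (0,1)) + Re (M (1,0) (1,0))"
proof -
  have fin: "finite (qubit \<times> qubit)" by (simp add: finite_qubit)
  show "0 \<le> Re (M (0,0) (0,0))" "0 \<le> Re (M (0,1) (0,1))" "0 \<le> Re (M (1,0) (1,0))" "0 \<le> Re (M (1,1) (1,1))"
    using psd_op_diag_ge_0(2)[OF assms _ fin] by (auto simp: in_qubit)
  have "psd_op {(0,0), (1,1)} M" "psd_op {(0,1), (1,0)} M"
    using fin by (auto intro!: psd_op_mono[OF assms] simp: in_qubit)
  from this[THEN psd_op_sum_ge_0] show
    "0 \<le> Re (M (0,0) (0,0)) + Re (M (0,0) (1,1)) + Re (M (1,1) (0,0)) + Re (M (1,1) (1,1))"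
    "0 \<le> Re (M (0,1) (0,1)) + Re (M (0,1) (1,0)) + Re (M (1,0) (0,1)) + Re (M (1,0) (1,0))"
    by (simp_all add: add.assoc)
qed

lemma trace_qubit: "trace_op qubit S = S 0 0 + S 1 1"
  by (simp add: trace_op_def sum_qubit)

text \<open>The value is attained by the feasible pair with \<epsilon> = 0. For the lower bound six
  inequalities are added: the entries of \<open>V\<close> cancel, and 2 Tr S \<ge> 2 + 2 sqrt (1 -
  \<gamma>) remains.\<close>

lemma zeta_amp_damp:
  assumes \<gamma>: "0 \<le> \<gamma>" "\<gamma> \<le> 1"
  shows "zeta qubit qubit (amp_damp \<gamma>) = 1 + sqrt (1 - \<gamma>)"
  unfolding zeta_def
proof (rule Least_equality)
  define s where "s = sqrt (1 - \<gamma>)"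
  define V where "V = x_op (1 + (s - s\<^sup>2) / 2) 0 \<gamma> ((s + s\<^sup>2) / 2) ((s + s\<^sup>2) / 2) 0"
  define S where "S = diag_op (\<lambda>b :: nat. (if b = 0 then 1 + (s - s\<^sup>2) / 2 else (s + s\<^sup>2) / 2) + 0)"
  interpret channel_feasible qubit qubit "amp_damp \<gamma>" V S
    unfolding V_def S_def s_def by (rule amp_damp_feasible[OF \<gamma> order_refl])
  have "psd_op (qubit \<times> qubit) (\<lambda>x y. ptranspose V x y + tensor_id S x y)"
    using SV' by (simp only: add.commute)
  moreover have "hermitian_op (qubit \<times> qubit) V" "hermitian_op qubit S"
    unfolding V_def S_def by (rule hermitian_x_op hermitian_diag_op)+
  moreover have "1 + s = Re (trace_op qubit S)"
    by (simp add: S_def trace_qubit diag_op_def field_simps)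
  ultimately show "\<exists>V S. hermitian_op (qubit \<times> qubit) V \<and> hermitian_op qubit S \<and>
     loewner_le (qubit \<times> qubit) (choi qubit (amp_damp \<gamma>)) V \<and>
     loewner_le (qubit \<times> qubit) (- tensor_op id_op S) (ptranspose V) \<and>
     loewner_le (qubit \<times> qubit) (ptranspose V) (tensor_op id_op S) \<and>
     1 + sqrt (1 - \<gamma>) = Re (trace_op qubit S)"
    unfolding loewner_le_uminus_iff unfolding loewner_le_iff tensor_op_id s_def[symmetric]
    using VJ SV by blast
next
  fix t assume "\<exists>V S. hermitian_op (qubit \<times> qubit) V \<and> hermitian_op qubit S \<and>
     loewner_le (qubit \<times> qubit) (choi qubit (amp_damp \<gamma>)) V \<and>
     loewner_le (qubit \<times> qubit) (- tensor_op id_op S) (ptranspose V) \<and>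
     loewner_le (qubit \<times> qubit) (ptranspose V) (tensor_op id_op S) \<and>
     t = Re (trace_op qubit S)"
  then obtain V S where
    VJ: "psd_op (qubit \<times> qubit) (\<lambda>x y. V x y - choi qubit (amp_damp \<gamma>) x y)" and
    SV: "psd_op (qubit \<times> qubit) (\<lambda>x y. tensor_id S x y - ptranspose V x y)" and
    t: "t = Re (trace_op qubit S)"
    unfolding loewner_le_iff tensor_op_id by blast
  \<comment> \<open>Pairing both constraints with the dual optimum, which is supported on
    \<open>|00\<rangle> + |11\<rangle>\<close>, \<open>|01\<rangle>\<close>, \<open>|10\<rangle>\<close> and, after partial transposition, on \<open>|01\<rangle> + |10\<rangle>\<close>, \<open>|00\<rangle>\<close>, \<open>|11\<rangle>\<close>.\<close>
  show "1 + sqrt (1 - \<gamma>) \<le> t"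
    using psd_op_qubit_sums(2,3,5)[OF VJ] psd_op_qubit_sums(1,4,6)[OF SV]
    by (simp add: t trace_qubit choi_amp_damp[OF \<gamma>] in_qubit x_op_def tensor_id_def ptranspose_def)
qed

text \<open>The optimal \<open>S\<close> is the one for \<open>zeta\<close>. In the lower bound the
  blocks 00/11 and 01/10 exchange their roles, because the Choi matrix now enters partially
  transposed; the entries of \<open>R\<close> cancel again.\<close>

lemma beta_amp_damp:
  assumes \<gamma>: "0 \<le> \<gamma>" "\<gamma> \<le> 1"
  shows "beta qubit qubit (amp_damp \<gamma>) = 1 + sqrt (1 - \<gamma>)"
  unfolding beta_def
proof (rule Least_equality)
  define s where "s = sqrt (1 - \<gamma>)"
  have s: "0 \<le> s" "s \<le> 1" and s2: "1 - \<gamma> = s\<^sup>2" "\<gamma> = 1 - s\<^sup>2"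
    using \<gamma> by (auto simp: s_def)
  have s2s: "s\<^sup>2 \<le> s" using s by (simp add: power2_eq_square mult_left_le)
  have s20: "0 \<le> s\<^sup>2" by simp
  define x where "x = (s - s\<^sup>2) / 2"
  define c where "c = (s + s\<^sup>2) / 2"
  have x: "0 \<le> x" and c: "0 \<le> c" using s s2s by (auto simp: x_def c_def)
  have xc: "x - s = - c" "x + s\<^sup>2 = c" "1 + x - \<gamma> = c" "x + c = s"
    by (auto simp: x_def c_def s2 field_simps)
  \<comment> \<open>The difference of \<open>R\<close> and the transposed Choi matrix has diagonal
    c, c and coupling -c on the block 01/10; that of 1 \<otimes> S and the transposed
    \<open>R\<close> has diagonal x, x and coupling -x on the block 00/11. Both vanish
    elsewhere.\<close>
  define R where "R = x_op 1 c (1 + x) (s\<^sup>2) 0 x"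
  define S where "S = diag_op (\<lambda>b :: nat. if b = 0 then 1 + x else c)"
  note J = choi_amp_damp[OF \<gamma>, folded s_def, unfolded s2(1)]
  have JT: "ptranspose (choi qubit (amp_damp \<gamma>)) y z = x_op 1 0 \<gamma> (s\<^sup>2) 0 s y z"
    if "y \<in> qubit \<times> qubit" "z \<in> qubit \<times> qubit" for y z
    using that by (auto simp: ptranspose_def J in_qubit x_op_def)
  have RJ: "psd_op (qubit \<times> qubit) (\<lambda>y z. R y z - ptranspose (choi qubit (amp_damp \<gamma>)) y z)"
  proof (rule psd_op_x_opI[of _ "1 - 1" _ _ "s\<^sup>2 - s\<^sup>2" "0 - 0" "x - s"])
    show "(x - s)\<^sup>2 \<le> (c - 0) * (1 + x - \<gamma>)" unfolding xc by (simp add: power2_eq_square)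
  qed (use x c xc in \<open>auto simp: R_def JT x_op_diff\<close>)
  have RJ': "psd_op (qubit \<times> qubit) (\<lambda>y z. ptranspose (choi qubit (amp_damp \<gamma>)) y z + R y z)"
  proof (rule psd_op_x_opI[of _ "1 + 1" _ _ "s\<^sup>2 + s\<^sup>2" "0 + 0" "s + x"])
    \<comment> \<open>This product is exactly the right side minus the left side of the determinant
      condition.\<close>
    have "0 \<le> s * ((1 - s) * (1 + s\<^sup>2))" using s by (intro mult_nonneg_nonneg) auto
    then show "(s + x)\<^sup>2 \<le> (0 + c) * (\<gamma> + (1 + x))"
      by (simp add: x_def c_def s2 power2_eq_square field_simps)
  qed (use x c \<gamma> in \<open>auto simp: R_def JT x_op_add\<close>)
  have SR: "psd_op (qubit \<times> qubit) (\<lambda>y z. tensor_id S y z - ptranspose R y z)"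
  proof (rule psd_op_x_opI[of _ _ "c - c" "1 + x - (1 + x)" _ "0 - x" "0 - 0"])
    show "(0 - x)\<^sup>2 \<le> (1 + x - 1) * (c - s\<^sup>2)"
      using xc(2) by (simp add: power2_eq_square flip: xc(2))
  qed (use x c xc in \<open>auto simp: S_def R_def tensor_id_diag_op ptranspose_x_op x_op_diff\<close>)
  have SR': "psd_op (qubit \<times> qubit) (\<lambda>y z. ptranspose R y z + tensor_id S y z)"
  proof (rule psd_op_x_opI[of _ _ "c + c" "1 + x + (1 + x)" _ "x + 0" "0 + 0"])
    have "x * x \<le> (2 + x) * (x + 2 * s\<^sup>2)" using x by (intro mult_mono) auto
    then show "(x + 0)\<^sup>2 \<le> (1 + (1 + x)) * (s\<^sup>2 + c)"
      by (simp add: power2_eq_square add.commute flip: xc(2))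
  qed (use x c s20 in \<open>auto simp: S_def R_def tensor_id_diag_op ptranspose_x_op x_op_add\<close>)
  have "hermitian_op (qubit \<times> qubit) R" "hermitian_op qubit S"
    unfolding R_def S_def by (rule hermitian_x_op hermitian_diag_op)+
  moreover have "1 + s = Re (trace_op qubit S)"
    using xc(4) by (simp add: S_def trace_qubit diag_op_def)
  ultimately show "\<exists>R S. hermitian_op (qubit \<times> qubit) R \<and> hermitian_op qubit S \<and>
     loewner_le (qubit \<times> qubit) (- R) (ptranspose (choi qubit (amp_damp \<gamma>))) \<and>
     loewner_le (qubit \<times> qubit) (ptranspose (choi qubit (amp_damp \<gamma>))) R \<and>
     loewner_le (qubit \<times> qubit) (- tensor_op id_op S) (ptranspose R) \<and>
     loewner_le (qubit \<times> qubit) (ptranspose R) (tensor_op id_op S) \<and>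
     1 + sqrt (1 - \<gamma>) = Re (trace_op qubit S)"
    unfolding loewner_le_uminus_iff unfolding loewner_le_iff tensor_op_id s_def[symmetric]
    using RJ RJ' SR SR' by blast
next
  fix t assume "\<exists>R S. hermitian_op (qubit \<times> qubit) R \<and> hermitian_op qubit S \<and>
     loewner_le (qubit \<times> qubit) (- R) (ptranspose (choi qubit (amp_damp \<gamma>))) \<and>
     loewner_le (qubit \<times> qubit) (ptranspose (choi qubit (amp_damp \<gamma>))) R \<and>
     loewner_le (qubit \<times> qubit) (- tensor_op id_op S) (ptranspose R) \<and>
     loewner_le (qubit \<times> qubit) (ptranspose R) (tensor_op id_op S) \<and>
     t = Re (trace_op qubit S)"
  then obtain R S where
    RJ: "psd_op (qubit \<times> qubit) (\<lambda>x y. R x y - ptranspose (choi qubit (amp_damp \<gamma>)) x y)" and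
    SR: "psd_op (qubit \<times> qubit) (\<lambda>x y. tensor_id S x y - ptranspose R x y)" and
    t: "t = Re (trace_op qubit S)"
    unfolding loewner_le_iff tensor_op_id by blast
  \<comment> \<open>Pairing both constraints with the dual optimum, which is supported on
    \<open>|00\<rangle> + |11\<rangle>\<close>, \<open>|01\<rangle>\<close>, \<open>|10\<rangle>\<close> and, after partial transposition, on \<open>|01\<rangle> + |10\<rangle>\<close>, \<open>|00\<rangle>\<close>, \<open>|11\<rangle>\<close>.\<close>
  show "1 + sqrt (1 - \<gamma>) \<le> t"
    using psd_op_qubit_sums(1,4,6)[OF RJ] psd_op_qubit_sums(2,3,5)[OF SR]
    by (simp add: t trace_qubit choi_amp_damp[OF \<gamma>] in_qubit x_op_def tensor_id_def ptranspose_def)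
qed

theorem theorem14:
  fixes \<gamma> :: real
  assumes "0 \<le> \<gamma>" and "\<gamma> \<le> 1"
  shows "C_nsppt qubit qubit (amp_damp \<gamma>) \<le> C_zeta qubit qubit (amp_damp \<gamma>) \<and>
         C_zeta qubit qubit (amp_damp \<gamma>) = C_beta qubit qubit (amp_damp \<gamma>) \<and>
         C_beta qubit qubit (amp_damp \<gamma>) = log 2 (1 + sqrt (1 - \<gamma>)) \<and>
         classical_capacity qubit qubit (amp_damp \<gamma>) \<le> log 2 (1 + sqrt (1 - \<gamma>))"
proof -
  define s where "s = sqrt (1 - \<gamma>)"
  have s: "0 \<le> s" "s \<le> 1" using assms by (auto simp: s_def)
  have s2s: "s\<^sup>2 \<le> s" using s by (simp add: power2_eq_square mult_left_le)
  have s20: "0 \<le> s + s\<^sup>2" using s by simp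
  let ?\<sigma> = "\<lambda>\<epsilon> b. (if b = (0 :: nat) then 1 + (s - s\<^sup>2) / 2 else (s + s\<^sup>2) / 2) + \<epsilon>"
  let ?V = "x_op (1 + (s - s\<^sup>2) / 2) 0 \<gamma> ((s + s\<^sup>2) / 2) ((s + s\<^sup>2) / 2) 0"
  have feasible: "channel_feasible qubit qubit (amp_damp \<gamma>) ?V (diag_op (?\<sigma> \<epsilon>))" if "0 \<le> \<epsilon>" for \<epsilon>
    unfolding s_def by (rule amp_damp_feasible[OF assms that])
  have "C_nsppt qubit qubit (amp_damp \<gamma>) \<le> log 2 (1 + s)"
  proof (rule channel_feasible.C_nsppt_le[OF feasible[OF order_refl]])
    show "trace_op qubit (diag_op (?\<sigma> 0)) = complex_of_real (1 + s)"
      by (simp add: trace_qubit diag_op_def field_simps)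
  qed (use s in simp)
  \<comment> \<open>At \<gamma> = 1 the weight (s + s^2) / 2 is zero, whereas the entropy bound
    takes logarithms of positive weights. The shift by \<epsilon> restores positivity and costs 2
    \<epsilon> in the trace, which vanishes in the limit.\<close>
  moreover have "classical_capacity qubit qubit (amp_damp \<gamma>) \<le> log 2 (1 + s)"
  proof (rule tendsto_lowerbound)
    have "((\<lambda>\<epsilon>. log 2 (1 + s + 2 * \<epsilon>)) \<longlongrightarrow> log 2 (1 + s + 2 * 0)) (at_right 0)"
      using s by (intro tendsto_intros) auto
    then show "((\<lambda>\<epsilon>. log 2 (1 + s + 2 * \<epsilon>)) \<longlongrightarrow> log 2 (1 + s)) (at_right 0)" by simp
    have "classical_capacity qubit qubit (amp_damp \<gamma>) \<le> log 2 (1 + s + 2 * \<epsilon>)" if "0 < \<epsilon>" for \<epsilon>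
    proof -
      have "classical_capacity qubit qubit (amp_damp \<gamma>) \<le> log 2 (\<Sum>b\<in>qubit. ?\<sigma> \<epsilon> b)"
        using s s2s s20 that
        by (intro channel_feasible.classical_capacity_le[OF feasible] refl) (auto intro!: add_nonneg_pos)
      also have "(\<Sum>b\<in>qubit. ?\<sigma> \<epsilon> b) = 1 + s + 2 * \<epsilon>" by (simp add: sum_qubit field_simps)
      finally show ?thesis .
    qed
    then show "\<forall>\<^sub>F \<epsilon> in at_right 0. classical_capacity qubit qubit (amp_damp \<gamma>) \<le> log 2 (1 + s + 2 * \<epsilon>)"
      by (simp add: eventually_at_filter)
  qed simp
  ultimately show ?thesis
    by (simp add: C_zeta_def C_beta_def zeta_amp_damp beta_amp_damp assms s_def)
qed

end
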